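(* With the notation fixed in the context, the couple $(X',b')$ satisfies the following universal property: for every 2-relative cluster family $(W,\theta)$ of $\pi$ such that the pullback $\theta^{-1}(E)$ is an effective Cartier divisor of $B\times W$, there is a unique morphism $f\colon W\to X'$ with $\theta=b'\circ(\mathrm{Id}_B\times f)$.
   Context: Work over a base field $\Bbbk$; all unadorned products are over $\Bbbk$. Let $\pi\colon\mathcal{S}\to B$ be a morphism of $\Bbbk$-schemes with $\mathcal{S}$ piecewise quasiprojective (a disjoint union of quasiprojective schemes) and $B$ projective and integral. A section family of a morphism $\mathcal{T}\to B$ is a couple $(W,\theta)$ with $W$ a $\Bbbk$-scheme and $\theta\colon B\times W\to\mathcal{T}$ a $B$-morphism. It is the universal section family if for every section family $(V,\sigma)$ there is a unique morphism $f\colon V\to W$ with $\sigma=\theta\circ(\mathrm{Id}_B\times f)$. Let $(X,\psi)$ be the universal section family of $\pi$ (it exists). Let $\mathcal{S}_0=\mathcal{S}\times X$, $\pi_0=\pi\times\mathrm{Id}_X\colon\mathcal{S}_0\to B\times X$, and let $p\colon B\times X\to B$ be the projection. Let $\iota$ be the automorphism of $B\times X\times X$ exchanging the second and third factors, and $\psi_0=(\psi\times\mathrm{Id}_X)\circ\iota\colon B\times X\times X\to\mathcal{S}_0$. Let $\Delta\subseteq\mathcal{S}_0$ be the image of the section $\psi\times_X\mathrm{Id}_X\colon B\times X\to\mathcal{S}\times X$ of $\pi_0$ (i.e. $(\beta,x)\mapsto(\psi(\beta,x),x)$). Let $\mathcal{S}_1$ be the blow up of $\mathcal{S}_0$ along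 $\Delta$, $E$ its exceptional divisor, $\pi_1\colon\mathcal{S}_1\to B\times X$ the composition of the blow up morphism with $\pi_0$, and $q_1\colon\mathcal{S}_1\to X$ the composition of the blow up morphism with the projection $\mathcal{S}_0\to X$. A morphism $u\colon P\to Q$ is constant along the fibres of $v\colon P\to R$ if $u\circ r_1=u\circ r_2$, where $r_1,r_2\colon P\times_R P\to P$ are the projections. A 2-relative cluster family of $\pi$ is a section family $(W,\theta)$ of $p\circ\pi_1\colon\mathcal{S}_1\to B$ such that $q_1\circ\theta$ is constant along the fibres of the projection $B\times W\to W$. $(X',b)$ is the blow up split section family of the projection $B\times X\times X\to B$ along $(\psi_0)^{-1}(\Delta)$: that is, $b\colon X'\to X\times X$ is such that the pullback of $(\psi_0)^{-1}(\Delta)$ by $\mathrm{Id}_B\times b\colon B\times X'\to B\times X\times X$ is an effective Cartier divisor, and every morphism $g\colon T\to X\times X$ for which the pullback of $(\psi_0)^{-1}(\Delta)$ by $\mathrm{Id}_B\times g$ is an effective Cartier divisor of $B\times T$ factors as $g=b\circ h$ for a unique $h\colon T\to X'$. Let $b'\colon B\times X'\to\mathcal{S}_1$ be the unique morphism whose composition with the blow up morphism $\mathcal{S}_1\to\mathcal{S}_0$ is $\psi_0\circ(\mathrm{Id}_B\times b)$. *)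

theory Defs
  imports
    "HOL-Analysis.Abstract_Topology"
    "HOL-Library.Disjoint_Sets"
    "HOL-Library.Multiset"
    "HOL-Algebra.Ideal"
begin

section \<open>Locally ringed spaces\<close>

text \<open>
  A sheaf of rings is given in the etale-space style: each point carries a ring (the stalk), and a
  section over an open set is a function choosing an element of the stalk at every point (its germs).
  Every sheaf of rings is isomorphic to one of this form; restriction is restriction of functions,
  and separatedness is automatic. The choice matters for size: the
  points and the germs live in fixed types, while the sections over a large open set are
  functions, so their number is not bounded by the size of the type of germs. Taking one infinite
  type \<open>'u\<close> for both gives a category of schemes that is closed under products with schemes
  locally of finite type over a field (finite type extensions do not enlarge an infinite bound),
  and every scheme is isomorphic to one over a large enough \<open>'u\<close>. Universal properties below
  quantify over the schemes of such a category.
\<close>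

record ('p, 'g) ringed_space =
  topo :: "'p topology"
  stalk :: "'p \<Rightarrow> 'g ring"
  sections :: "'p set \<Rightarrow> ('p \<Rightarrow> 'g) set"

abbreviation points :: "('p, 'g) ringed_space \<Rightarrow> 'p set" where
  "points X \<equiv> topspace (topo X)"

definition section_ring :: "('p, 'g) ringed_space \<Rightarrow> 'p set \<Rightarrow> ('p \<Rightarrow> 'g) ring" where
  "section_ring X U =
    \<lparr> carrier = sections X U,
      monoid.mult = (\<lambda>s t. \<lambda>x\<in>U. s x \<otimes>\<^bsub>stalk X x\<^esub> t x),
      one = (\<lambda>x\<in>U. \<one>\<^bsub>stalk X x\<^esub>),
      zero = (\<lambda>x\<in>U. \<zero>\<^bsub>stalk X x\<^esub>),
      add = (\<lambda>s t. \<lambda>x\<in>U. s x \<oplus>\<^bsub>stalk X x\<^esub> t x) \<rparr>"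

text \<open>
  The last two conditions say that the ring at \<open>x\<close> is the colimit of the rings of
  sections over the open neighbourhoods of \<open>x\<close>.
\<close>

definition ringed_space :: "('p, 'g) ringed_space \<Rightarrow> bool" where
  "ringed_space X \<longleftrightarrow>
    (\<forall>x\<in>points X. cring (stalk X x)) \<and>
    (\<forall>U. openin (topo X) U \<longrightarrow>
      sections X U \<subseteq> (\<Pi>\<^sub>E x\<in>U. carrier (stalk X x)) \<and> cring (section_ring X U)) \<and>
    (\<forall>U V s. openin (topo X) U \<longrightarrow> openin (topo X) V \<longrightarrow> V \<subseteq> U \<longrightarrow> s \<in> sections X U \<longrightarrow>
      restrict s V \<in> sections X V) \<and>
    (\<forall>U s. openin (topo X) U \<longrightarrow> s \<in> (\<Pi>\<^sub>E x\<in>U. carrier (stalk X x)) \<longrightarrow>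
      (\<forall>x\<in>U. \<exists>V. openin (topo X) V \<and> x \<in> V \<and> V \<subseteq> U \<and> restrict s V \<in> sections X V) \<longrightarrow>
      s \<in> sections X U) \<and>
    (\<forall>x\<in>points X. \<forall>a\<in>carrier (stalk X x).
      \<exists>U. openin (topo X) U \<and> x \<in> U \<and> (\<exists>s\<in>sections X U. s x = a)) \<and>
    (\<forall>U. openin (topo X) U \<longrightarrow> (\<forall>s\<in>sections X U. \<forall>t\<in>sections X U. \<forall>x\<in>U. s x = t x \<longrightarrow>
      (\<exists>V. openin (topo X) V \<and> x \<in> V \<and> V \<subseteq> U \<and> (\<forall>y\<in>V. s y = t y))))"

definition local_ring :: "'a ring \<Rightarrow> bool" where
  "local_ring R \<longleftrightarrow> cring R \<and> (\<exists>!I. maximalideal I R)"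

definition locally_ringed_space :: "('p, 'g) ringed_space \<Rightarrow> bool" where
  "locally_ringed_space X \<longleftrightarrow> ringed_space X \<and> (\<forall>x\<in>points X. local_ring (stalk X x))"

definition open_subspace :: "('p, 'g) ringed_space \<Rightarrow> 'p set \<Rightarrow> ('p, 'g) ringed_space" where
  "open_subspace X U = \<lparr> topo = subtopology (topo X) U, stalk = stalk X, sections = sections X \<rparr>"

text \<open>
  Morphisms carry their source and target. The sheaf part of \<open>f : X \<rightarrow> Y\<close> is the family of stalk
  homomorphisms from the stalk of \<open>Y\<close> at \<open>f x\<close> to the stalk of \<open>X\<close> at \<open>x\<close>; it comes from a
  homomorphism of sheaves iff it pulls sections back to sections. All maps are extensional, so
  that equality of morphisms is equality of records.
\<close>

record ('p, 'g, 'q, 'h) morphism =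
  Dom :: "('p, 'g) ringed_space"
  Cod :: "('q, 'h) ringed_space"
  pmap :: "'p \<Rightarrow> 'q"
  smap :: "'p \<Rightarrow> 'h \<Rightarrow> 'g"

definition pullback_section ::
    "('p, 'g, 'q, 'h) morphism \<Rightarrow> 'q set \<Rightarrow> ('q \<Rightarrow> 'h) \<Rightarrow> 'p \<Rightarrow> 'g" where
  "pullback_section f V s =
    (\<lambda>x \<in> {x \<in> points (Dom f). pmap f x \<in> V}. smap f x (s (pmap f x)))"

definition Mor ::
    "('p, 'g) ringed_space \<Rightarrow> ('q, 'h) ringed_space \<Rightarrow> ('p, 'g, 'q, 'h) morphism set" where
  "Mor X Y = {f. Dom f = X \<and> Cod f = Y \<and>
    continuous_map (topo X) (topo Y) (pmap f) \<and>
    pmap f \<in> extensional (points X) \<and> smap f \<in> extensional (points X) \<and>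
    (\<forall>x\<in>points X.
      smap f x \<in> ring_hom (stalk Y (pmap f x)) (stalk X x) \<and>
      smap f x \<in> extensional (carrier (stalk Y (pmap f x))) \<and>
      (\<forall>a\<in>carrier (stalk Y (pmap f x)).
        smap f x a \<in> Units (stalk X x) \<longrightarrow> a \<in> Units (stalk Y (pmap f x)))) \<and>
    (\<forall>V. openin (topo Y) V \<longrightarrow> (\<forall>s\<in>sections Y V.
      pullback_section f V s \<in> sections X {x \<in> points X. pmap f x \<in> V}))}"

definition mcomp ::
    "('q, 'h, 'r, 'i) morphism \<Rightarrow> ('p, 'g, 'q, 'h) morphism \<Rightarrow> ('p, 'g, 'r, 'i) morphism"
    (infixl "\<circ>\<^sub>m" 55) where
  "g \<circ>\<^sub>m f =
    \<lparr> Dom = Dom f, Cod = Cod g,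
      pmap = (\<lambda>x\<in>points (Dom f). pmap g (pmap f x)),
      smap = (\<lambda>x\<in>points (Dom f). \<lambda>a\<in>carrier (stalk (Cod g) (pmap g (pmap f x))).
        smap f x (smap g (pmap f x) a)) \<rparr>"

definition inclusion :: "('p, 'g) ringed_space \<Rightarrow> 'p set \<Rightarrow> ('p, 'g, 'p, 'g) morphism" where
  "inclusion X U =
    \<lparr> Dom = open_subspace X U, Cod = X,
      pmap = (\<lambda>x\<in>points X \<inter> U. x),
      smap = (\<lambda>x\<in>points X \<inter> U. \<lambda>a\<in>carrier (stalk X x). a) \<rparr>"

definition idm :: "('p, 'g) ringed_space \<Rightarrow> ('p, 'g, 'p, 'g) morphism" where
  "idm X =
    \<lparr> Dom = X, Cod = X,
      pmap = (\<lambda>x\<in>points X. x),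
      smap = (\<lambda>x\<in>points X. \<lambda>a\<in>carrier (stalk X x). a) \<rparr>"

definition isomorphic_lrs :: "('p, 'g) ringed_space \<Rightarrow> ('q, 'h) ringed_space \<Rightarrow> bool" where
  "isomorphic_lrs X Y \<longleftrightarrow>
    (\<exists>f\<in>Mor X Y. \<exists>g\<in>Mor Y X. g \<circ>\<^sub>m f = idm X \<and> f \<circ>\<^sub>m g = idm Y)"

definition open_immersion :: "('p, 'g, 'q, 'h) morphism \<Rightarrow> bool" where
  "open_immersion f \<longleftrightarrow> f \<in> Mor (Dom f) (Cod f) \<and>
    embedding_map (topo (Dom f)) (topo (Cod f)) (pmap f) \<and>
    openin (topo (Cod f)) (pmap f ` points (Dom f)) \<and>
    (\<forall>x\<in>points (Dom f).
      bij_betw (smap f x) (carrier (stalk (Cod f) (pmap f x))) (carrier (stalk (Dom f) x)))"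

definition closed_immersion :: "('p, 'g, 'q, 'h) morphism \<Rightarrow> bool" where
  "closed_immersion f \<longleftrightarrow> f \<in> Mor (Dom f) (Cod f) \<and>
    embedding_map (topo (Dom f)) (topo (Cod f)) (pmap f) \<and>
    closedin (topo (Cod f)) (pmap f ` points (Dom f)) \<and>
    (\<forall>x\<in>points (Dom f).
      smap f x ` carrier (stalk (Cod f) (pmap f x)) = carrier (stalk (Dom f) x))"


section \<open>Spec and Proj\<close>

text \<open>
  Spec and Proj share one construction. \<open>D\<close> is the set of allowed pairs (numerator, denominator):
  all pairs for Spec, pairs of homogeneous elements of equal degree for Proj. The condition
  \<open>(u, u) \<in> D\<close> then says that \<open>u\<close> is an arbitrary, respectively homogeneous, element.
\<close>

definition fraction ::
    "'r ring \<Rightarrow> ('r \<times> 'r) set \<Rightarrow> 'r set \<Rightarrow> 'r \<Rightarrow> 'r \<Rightarrow> ('r \<times> 'r) set" where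
  "fraction R D p a s = {(b, t) \<in> D. t \<notin> p \<and>
    (\<exists>u. (u, u) \<in> D \<and> u \<notin> p \<and> u \<otimes>\<^bsub>R\<^esub> (a \<otimes>\<^bsub>R\<^esub> t) = u \<otimes>\<^bsub>R\<^esub> (b \<otimes>\<^bsub>R\<^esub> s))}"

definition localization ::
    "'r ring \<Rightarrow> ('r \<times> 'r) set \<Rightarrow> 'r set \<Rightarrow> ('r \<times> 'r) set ring" where
  "localization R D p =
    \<lparr> carrier = {fraction R D p a s | a s. (a, s) \<in> D \<and> s \<notin> p},
      monoid.mult = (\<lambda>A B. \<Union>(a, s)\<in>A. \<Union>(b, t)\<in>B. fraction R D p (a \<otimes>\<^bsub>R\<^esub> b) (s \<otimes>\<^bsub>R\<^esub> t)),
      one = fraction R D p \<one>\<^bsub>R\<^esub> \<one>\<^bsub>R\<^esub>,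
      zero = fraction R D p \<zero>\<^bsub>R\<^esub> \<one>\<^bsub>R\<^esub>,
      add = (\<lambda>A B. \<Union>(a, s)\<in>A. \<Union>(b, t)\<in>B.
        fraction R D p ((a \<otimes>\<^bsub>R\<^esub> t) \<oplus>\<^bsub>R\<^esub> (b \<otimes>\<^bsub>R\<^esub> s)) (s \<otimes>\<^bsub>R\<^esub> t)) \<rparr>"

definition zariski :: "'r ring \<Rightarrow> 'r set set \<Rightarrow> 'r set topology" where
  "zariski R P = topology (\<lambda>U. \<exists>A \<subseteq> carrier R. U = {p \<in> P. \<not> A \<subseteq> p})"

lemma istopology_zariski:
  assumes "\<And>p. p \<in> P \<Longrightarrow> primeideal p R"
  shows "istopology (\<lambda>U. \<exists>A \<subseteq> carrier R. U = {p \<in> P. \<not> A \<subseteq> p})"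
  unfolding istopology_def
proof (intro conjI allI impI)
  fix S T
  assume "\<exists>A\<subseteq>carrier R. S = {p \<in> P. \<not> A \<subseteq> p}" "\<exists>A\<subseteq>carrier R. T = {p \<in> P. \<not> A \<subseteq> p}"
  then obtain A C where A: "A \<subseteq> carrier R" "S = {p \<in> P. \<not> A \<subseteq> p}"
    and C: "C \<subseteq> carrier R" "T = {p \<in> P. \<not> C \<subseteq> p}" by blast
  let ?M = "if P = {} then {} else {a \<otimes>\<^bsub>R\<^esub> c | a c. a \<in> A \<and> c \<in> C}"
  have prod_in: "a \<otimes>\<^bsub>R\<^esub> c \<in> carrier R" if "p \<in> P" "a \<in> A" "c \<in> C" for p a c
  proof -
    interpret primeideal p R using assms that(1) by blast
    show ?thesis using A(1) C(1) that by (meson m_closed subsetD)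
  qed
  have "?M \<subseteq> carrier R" using prod_in by auto
  moreover have "S \<inter> T = {p \<in> P. \<not> ?M \<subseteq> p}"
  proof (intro Set.set_eqI)
    fix p show "p \<in> S \<inter> T \<longleftrightarrow> p \<in> {p \<in> P. \<not> ?M \<subseteq> p}"
    proof (cases "p \<in> P")
      case True
      interpret primeideal p R using assms True by blast
      have "a \<otimes>\<^bsub>R\<^esub> c \<in> p \<longleftrightarrow> a \<in> p \<or> c \<in> p" if "a \<in> A" "c \<in> C" for a c
        using I_prime I_l_closed I_r_closed that A(1) C(1) by (meson subsetD)
      then have "{a \<otimes>\<^bsub>R\<^esub> c | a c. a \<in> A \<and> c \<in> C} \<subseteq> p \<longleftrightarrow> (\<forall>a\<in>A. \<forall>c\<in>C. a \<in> p \<or> c \<in> p)"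
        by blast
      then have "?M \<subseteq> p \<longleftrightarrow> A \<subseteq> p \<or> C \<subseteq> p" using True by auto
      then show ?thesis using True A(2) C(2) by blast
    qed (use A C in auto)
  qed
  ultimately show "\<exists>A\<subseteq>carrier R. S \<inter> T = {p \<in> P. \<not> A \<subseteq> p}" by blast
next
  fix \<K> assume *: "\<forall>K\<in>\<K>. \<exists>A\<subseteq>carrier R. K = {p \<in> P. \<not> A \<subseteq> p}"
  then obtain A where A: "\<And>K. K \<in> \<K> \<Longrightarrow> A K \<subseteq> carrier R \<and> K = {p \<in> P. \<not> A K \<subseteq> p}" by metis
  have "\<Union>\<K> = {p \<in> P. \<not> (\<Union>K\<in>\<K>. A K) \<subseteq> p}"
  proof (intro Set.set_eqI iffI)
    fix p assume "p \<in> \<Union>\<K>"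
    then obtain K where "K \<in> \<K>" "p \<in> K" by blast
    moreover from this have "p \<in> P \<and> \<not> A K \<subseteq> p" using A by blast
    ultimately show "p \<in> {p \<in> P. \<not> (\<Union>K\<in>\<K>. A K) \<subseteq> p}" by blast
  next
    fix p assume "p \<in> {p \<in> P. \<not> (\<Union>K\<in>\<K>. A K) \<subseteq> p}"
    then obtain K where "K \<in> \<K>" "p \<in> P" "\<not> A K \<subseteq> p" by blast
    then show "p \<in> \<Union>\<K>" using A by blast
  qed
  moreover have "(\<Union>K\<in>\<K>. A K) \<subseteq> carrier R" using A by blast
  ultimately show "\<exists>A\<subseteq>carrier R. \<Union>\<K> = {p \<in> P. \<not> A \<subseteq> p}" by blast
qed

definition fraction_space ::
    "'r ring \<Rightarrow> ('r \<times> 'r) set \<Rightarrow> 'r set set \<Rightarrow> ('r set, ('r \<times> 'r) set) ringed_space" where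
  "fraction_space R D P =
    \<lparr> topo = zariski R P,
      stalk = localization R D,
      sections = (\<lambda>U. {s \<in> (\<Pi>\<^sub>E p\<in>U. carrier (localization R D p)).
        \<forall>p\<in>U. \<exists>V. openin (zariski R P) V \<and> p \<in> V \<and> V \<subseteq> U \<and>
          (\<exists>(a, f)\<in>D. \<forall>q\<in>V. f \<notin> q \<and> s q = fraction R D q a f)}) \<rparr>"

definition Spec :: "'r ring \<Rightarrow> ('r set, ('r \<times> 'r) set) ringed_space" where
  "Spec R = fraction_space R (carrier R \<times> carrier R) {p. primeideal p R}"

text \<open>\<open>G d\<close> is the set of homogeneous elements of degree \<open>d\<close>.\<close>

definition homogeneous_pairs :: "(nat \<Rightarrow> 'r set) \<Rightarrow> ('r \<times> 'r) set" where
  "homogeneous_pairs G = (\<Union>d. G d \<times> G d)"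

definition Proj :: "'r ring \<Rightarrow> (nat \<Rightarrow> 'r set) \<Rightarrow> ('r set, ('r \<times> 'r) set) ringed_space" where
  "Proj R G = fraction_space R (homogeneous_pairs G)
    {p. primeideal p R \<and> p = genideal R (p \<inter> (\<Union>d. G d)) \<and> \<not> (\<Union>d\<in>{0<..}. G d) \<subseteq> p}"

text \<open>The morphism \<open>Proj R \<rightarrow> Spec K\<close> given by a ring homomorphism \<open>h\<close> from \<open>K\<close> into degree 0.\<close>

definition Proj_to_Spec ::
    "'r ring \<Rightarrow> (nat \<Rightarrow> 'r set) \<Rightarrow> 'k ring \<Rightarrow> ('k \<Rightarrow> 'r) \<Rightarrow>
     ('r set, ('r \<times> 'r) set, 'k set, ('k \<times> 'k) set) morphism" where
  "Proj_to_Spec R G K h =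
    \<lparr> Dom = Proj R G, Cod = Spec K,
      pmap = (\<lambda>p\<in>points (Proj R G). {c \<in> carrier K. h c \<in> p}),
      smap = (\<lambda>p\<in>points (Proj R G).
        \<lambda>A\<in>carrier (stalk (Spec K) {c \<in> carrier K. h c \<in> p}).
          \<Union>(a, s)\<in>A. fraction R (homogeneous_pairs G) p (h a) (h s)) \<rparr>"


section \<open>Schemes and schemes over a field\<close>

text \<open>
  \<open>R\<close> may be taken to be the ring of global sections, so the type of \<open>R\<close> in the following
  definition is no restriction.
\<close>

definition affine_scheme :: "('p, 'g) ringed_space \<Rightarrow> bool" where
  "affine_scheme X \<longleftrightarrow> (\<exists>R :: ('p \<Rightarrow> 'g) ring. cring R \<and> isomorphic_lrs X (Spec R))"

definition scheme :: "('p, 'g) ringed_space \<Rightarrow> bool" where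
  "scheme X \<longleftrightarrow> locally_ringed_space X \<and>
    (\<forall>x\<in>points X. \<exists>U. openin (topo X) U \<and> x \<in> U \<and> affine_scheme (open_subspace X U))"

definition integral_scheme :: "('p, 'g) ringed_space \<Rightarrow> bool" where
  "integral_scheme X \<longleftrightarrow> scheme X \<and> points X \<noteq> {} \<and>
    (\<forall>U. openin (topo X) U \<longrightarrow> U \<noteq> {} \<longrightarrow> domain (section_ring X U))"

text \<open>A scheme over \<open>K\<close> is represented by its structure morphism; the scheme itself is its \<open>Dom\<close>.\<close>

type_synonym ('p, 'g, 'k) kscheme = "('p, 'g, 'k set, ('k \<times> 'k) set) morphism"

definition kscheme :: "'k ring \<Rightarrow> ('p, 'g, 'k) kscheme \<Rightarrow> bool" where
  "kscheme K X \<longleftrightarrow> scheme (Dom X) \<and> X \<in> Mor (Dom X) (Spec K)"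

definition KMor ::
    "('p, 'g, 'k) kscheme \<Rightarrow> ('q, 'h, 'k) kscheme \<Rightarrow> ('p, 'g, 'q, 'h) morphism set" where
  "KMor X Y = {f \<in> Mor (Dom X) (Dom Y). Y \<circ>\<^sub>m f = X}"

text \<open>\<open>K[x\<^sub>0, \<dots>, x\<^sub>n]\<close>; a polynomial is the function sending a monomial to its coefficient.\<close>

definition const_polynomial :: "'k ring \<Rightarrow> 'k \<Rightarrow> nat multiset \<Rightarrow> 'k" where
  "const_polynomial K c = (\<lambda>m. if m = {#} then c else \<zero>\<^bsub>K\<^esub>)"

definition polynomial_ring :: "'k ring \<Rightarrow> nat \<Rightarrow> (nat multiset \<Rightarrow> 'k) ring" where
  "polynomial_ring K n =
    \<lparr> carrier = {p. range p \<subseteq> carrier K \<and> finite {m. p m \<noteq> \<zero>\<^bsub>K\<^esub>} \<and>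
        (\<forall>m. p m \<noteq> \<zero>\<^bsub>K\<^esub> \<longrightarrow> set_mset m \<subseteq> {..n})},
      monoid.mult = (\<lambda>p q m. finsum K (\<lambda>a. p a \<otimes>\<^bsub>K\<^esub> q (m - a)) {a. a \<subseteq># m}),
      one = const_polynomial K \<one>\<^bsub>K\<^esub>,
      zero = const_polynomial K \<zero>\<^bsub>K\<^esub>,
      add = (\<lambda>p q m. p m \<oplus>\<^bsub>K\<^esub> q m) \<rparr>"

definition forms :: "'k ring \<Rightarrow> nat \<Rightarrow> nat \<Rightarrow> (nat multiset \<Rightarrow> 'k) set" where
  "forms K n d = {p \<in> carrier (polynomial_ring K n). \<forall>m. p m \<noteq> \<zero>\<^bsub>K\<^esub> \<longrightarrow> size m = d}"

definition projective_space ::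
    "'k ring \<Rightarrow> nat \<Rightarrow>
     ((nat multiset \<Rightarrow> 'k) set, ((nat multiset \<Rightarrow> 'k) \<times> (nat multiset \<Rightarrow> 'k)) set, 'k) kscheme" where
  "projective_space K n =
    Proj_to_Spec (polynomial_ring K n) (forms K n) K (const_polynomial K)"

definition projective :: "'k ring \<Rightarrow> ('p, 'g, 'k) kscheme \<Rightarrow> bool" where
  "projective K X \<longleftrightarrow> kscheme K X \<and>
    (\<exists>n. \<exists>i\<in>KMor X (projective_space K n). closed_immersion i)"

definition quasiprojective :: "'k ring \<Rightarrow> ('p, 'g, 'k) kscheme \<Rightarrow> bool" where
  "quasiprojective K X \<longleftrightarrow> kscheme K X \<and>
    (\<exists>Y :: ('p, 'g, 'k) kscheme. projective K Y \<and> (\<exists>j\<in>KMor X Y. open_immersion j))"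

definition piecewise_quasiprojective :: "'k ring \<Rightarrow> ('p, 'g, 'k) kscheme \<Rightarrow> bool" where
  "piecewise_quasiprojective K X \<longleftrightarrow> kscheme K X \<and>
    (\<exists>\<U>. \<Union>\<U> = points (Dom X) \<and> disjoint \<U> \<and>
      (\<forall>U\<in>\<U>. openin (topo (Dom X)) U \<and> quasiprojective K (X \<circ>\<^sub>m inclusion (Dom X) U)))"


section \<open>Fibre products\<close>

text \<open>
  \<open>c = (p, q)\<close> is a fibre product of \<open>f\<close> and \<open>g\<close>, with apex \<open>Dom p = Dom q\<close>. For schemes over \<open>K\<close>,
  represented by their structure morphisms, this is the product over \<open>K\<close>, and it is itself a
  scheme over \<open>K\<close> through \<open>f \<circ>\<^sub>m p\<close>.
\<close>

type_synonym ('p, 'g, 'q, 'h, 'r, 'i) cone = "('p, 'g, 'q, 'h) morphism \<times> ('p, 'g, 'r, 'i) morphism"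

abbreviation Apex :: "('p, 'g, 'q, 'h, 'r, 'i) cone \<Rightarrow> ('p, 'g) ringed_space" where
  "Apex c \<equiv> Dom (fst c)"

definition fibre_product ::
    "('p, 'g, 's, 't) morphism \<Rightarrow> ('p, 'g, 's, 't) morphism \<Rightarrow> ('p, 'g, 'p, 'g, 'p, 'g) cone \<Rightarrow> bool"
  where
  "fibre_product f g c \<longleftrightarrow> scheme (Apex c) \<and>
    fst c \<in> Mor (Apex c) (Dom f) \<and> snd c \<in> Mor (Apex c) (Dom g) \<and> f \<circ>\<^sub>m fst c = g \<circ>\<^sub>m snd c \<and>
    (\<forall>T :: ('p, 'g) ringed_space. \<forall>a\<in>Mor T (Dom f). \<forall>b\<in>Mor T (Dom g).
      scheme T \<longrightarrow> f \<circ>\<^sub>m a = g \<circ>\<^sub>m b \<longrightarrow>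
      (\<exists>!h. h \<in> Mor T (Apex c) \<and> fst c \<circ>\<^sub>m h = a \<and> snd c \<circ>\<^sub>m h = b))"

text \<open>The morphism with components \<open>a\<close>, \<open>b\<close>, and the product \<open>f \<times> g\<close> of two morphisms.\<close>

definition pair_mor ::
    "('p, 'g, 'q, 'h, 'r, 'i) cone \<Rightarrow> ('s, 't, 'q, 'h) morphism \<Rightarrow> ('s, 't, 'r, 'i) morphism \<Rightarrow>
     ('s, 't, 'p, 'g) morphism" where
  "pair_mor c a b = (THE h. h \<in> Mor (Dom a) (Apex c) \<and> fst c \<circ>\<^sub>m h = a \<and> snd c \<circ>\<^sub>m h = b)"

definition prod_mor ::
    "('p, 'g, 'q, 'h, 'r, 'i) cone \<Rightarrow> ('p, 'g, 'q, 'h, 'r, 'i) cone \<Rightarrow>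
     ('q, 'h, 'q, 'h) morphism \<Rightarrow> ('r, 'i, 'r, 'i) morphism \<Rightarrow> ('p, 'g, 'p, 'g) morphism" where
  "prod_mor c' c f g = pair_mor c (f \<circ>\<^sub>m fst c') (g \<circ>\<^sub>m snd c')"

definition constant_along_fibres ::
    "('p, 'g, 'q, 'h) morphism \<Rightarrow> ('p, 'g, 'r, 'i) morphism \<Rightarrow> bool" where
  "constant_along_fibres u v \<longleftrightarrow> (\<exists>c. fibre_product v v c \<and> u \<circ>\<^sub>m fst c = u \<circ>\<^sub>m snd c)"


section \<open>Closed subschemes, effective Cartier divisors and blow ups\<close>

text \<open>
  A closed subscheme is represented by its (quasi-coherent) sheaf of ideals, given by its stalks.
  \<open>image_ideal f\<close> is the kernel of \<open>\<O>\<^sub>Y \<rightarrow> f\<^sub>* \<O>\<^sub>X\<close>, that is, the ideal of the scheme-theoretic image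
  of \<open>f : X \<rightarrow> Y\<close>; if \<open>f\<close> is a closed immersion, it is the ideal of the closed subscheme \<open>f\<close>.
  \<open>inverse_image_ideal g I\<close> is the ideal \<open>g\<^sup>-\<^sup>1 I \<cdot> \<O>\<close> of the inverse image scheme.
\<close>

type_synonym ('p, 'g) ideal_sheaf = "'p \<Rightarrow> 'g set"

definition image_ideal :: "('p, 'g, 'q, 'h) morphism \<Rightarrow> ('q, 'h) ideal_sheaf" where
  "image_ideal f = (\<lambda>y\<in>points (Cod f). {s y | U s.
    openin (topo (Cod f)) U \<and> y \<in> U \<and> s \<in> sections (Cod f) U \<and>
    (\<forall>x\<in>points (Dom f). pmap f x \<in> U \<longrightarrow> smap f x (s (pmap f x)) = \<zero>\<^bsub>stalk (Dom f) x\<^esub>)})"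

definition inverse_image_ideal ::
    "('p, 'g, 'q, 'h) morphism \<Rightarrow> ('q, 'h) ideal_sheaf \<Rightarrow> ('p, 'g) ideal_sheaf" where
  "inverse_image_ideal g I =
    (\<lambda>x\<in>points (Dom g). genideal (stalk (Dom g) x) (smap g x ` I (pmap g x)))"

definition effective_Cartier :: "('p, 'g) ringed_space \<Rightarrow> ('p, 'g) ideal_sheaf \<Rightarrow> bool" where
  "effective_Cartier X I \<longleftrightarrow> (\<forall>x\<in>points X. \<exists>U s.
    openin (topo X) U \<and> x \<in> U \<and> s \<in> sections X U \<and>
    (\<forall>y\<in>U. I y = cgenideal (stalk X y) (s y) \<and>
      (\<forall>a\<in>carrier (stalk X y). a \<otimes>\<^bsub>stalk X y\<^esub> s y = \<zero>\<^bsub>stalk X y\<^esub> \<longrightarrow> a = \<zero>\<^bsub>stalk X y\<^esub>)))"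

definition blow_up :: "('p, 'g, 'p, 'g) morphism \<Rightarrow> ('p, 'g) ideal_sheaf \<Rightarrow> bool" where
  "blow_up \<beta> I \<longleftrightarrow> scheme (Dom \<beta>) \<and> \<beta> \<in> Mor (Dom \<beta>) (Cod \<beta>) \<and>
    effective_Cartier (Dom \<beta>) (inverse_image_ideal \<beta> I) \<and>
    (\<forall>T :: ('p, 'g) ringed_space. \<forall>g\<in>Mor T (Cod \<beta>). scheme T \<longrightarrow> effective_Cartier T (inverse_image_ideal g I) \<longrightarrow>
      (\<exists>!h. h \<in> Mor T (Dom \<beta>) \<and> \<beta> \<circ>\<^sub>m h = g))"


section \<open>Section families\<close>

text \<open>
  In the following definitions a product \<open>B \<times> W\<close> is not chosen: the cone \<open>BW\<close> is any product of
  \<open>B\<close> and \<open>W\<close>, and the universal properties range over all of them.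
\<close>

definition section_family ::
    "'k ring \<Rightarrow> ('p, 'g, 'k) kscheme \<Rightarrow> ('p, 'g, 'p, 'g) morphism \<Rightarrow> ('p, 'g, 'k) kscheme \<Rightarrow>
     ('p, 'g, 'p, 'g, 'p, 'g) cone \<Rightarrow> ('p, 'g, 'p, 'g) morphism \<Rightarrow> bool" where
  "section_family K B \<tau> W BW \<theta> \<longleftrightarrow> kscheme K W \<and> fibre_product B W BW \<and>
    \<theta> \<in> Mor (Apex BW) (Dom \<tau>) \<and> \<tau> \<circ>\<^sub>m \<theta> = fst BW"

definition universal_section_family ::
    "'k ring \<Rightarrow> ('p, 'g, 'k) kscheme \<Rightarrow> ('p, 'g, 'p, 'g) morphism \<Rightarrow> ('p, 'g, 'k) kscheme \<Rightarrow>
     ('p, 'g, 'p, 'g, 'p, 'g) cone \<Rightarrow> ('p, 'g, 'p, 'g) morphism \<Rightarrow> bool" where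
  "universal_section_family K B \<tau> W BW \<theta> \<longleftrightarrow> section_family K B \<tau> W BW \<theta> \<and>
    (\<forall>V BV \<sigma>. section_family K B \<tau> V BV \<sigma> \<longrightarrow>
      (\<exists>!f. f \<in> KMor V W \<and> \<sigma> = \<theta> \<circ>\<^sub>m prod_mor BV BW (idm (Dom B)) f))"

text \<open>\<open>\<rho>\<close> plays the role of \<open>p \<circ> \<pi>\<^sub>1\<close> and \<open>q\<^sub>1\<close> that of the projection to \<open>X\<close>.\<close>

definition relative_cluster_family2 ::
    "'k ring \<Rightarrow> ('p, 'g, 'k) kscheme \<Rightarrow> ('p, 'g, 'p, 'g) morphism \<Rightarrow> ('p, 'g, 'p, 'g) morphism \<Rightarrow>
     ('p, 'g, 'k) kscheme \<Rightarrow> ('p, 'g, 'p, 'g, 'p, 'g) cone \<Rightarrow> ('p, 'g, 'p, 'g) morphism \<Rightarrow> bool" where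
  "relative_cluster_family2 K B \<rho> q\<^sub>1 W BW \<theta> \<longleftrightarrow>
    section_family K B \<rho> W BW \<theta> \<and> constant_along_fibres (q\<^sub>1 \<circ>\<^sub>m \<theta>) (snd BW)"

text \<open>Blow up split section family \<open>(Y', b)\<close> of the projection \<open>B \<times> Y \<rightarrow> B\<close> along the ideal \<open>I\<close>.\<close>

definition blow_up_split ::
    "'k ring \<Rightarrow> ('p, 'g, 'k) kscheme \<Rightarrow> ('p, 'g, 'k) kscheme \<Rightarrow> ('p, 'g, 'p, 'g, 'p, 'g) cone \<Rightarrow>
     ('p, 'g) ideal_sheaf \<Rightarrow> ('p, 'g, 'k) kscheme \<Rightarrow> ('p, 'g, 'p, 'g, 'p, 'g) cone \<Rightarrow>
     ('p, 'g, 'p, 'g) morphism \<Rightarrow> bool" where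
  "blow_up_split K B Y BY I Y' BY' b \<longleftrightarrow>
    kscheme K Y' \<and> fibre_product B Y' BY' \<and> b \<in> KMor Y' Y \<and>
    effective_Cartier (Apex BY') (inverse_image_ideal (prod_mor BY' BY (idm (Dom B)) b) I) \<and>
    (\<forall>T BT. \<forall>g\<in>KMor T Y. kscheme K T \<longrightarrow> fibre_product B T BT \<longrightarrow>
      effective_Cartier (Apex BT) (inverse_image_ideal (prod_mor BT BY (idm (Dom B)) g) I) \<longrightarrow>
      (\<exists>!h. h \<in> KMor T Y' \<and> g = b \<circ>\<^sub>m h))"

end

(*
  As X represents sections, a morphism u from B x W to X is the same as the family of sections
  psi(b', u(b, w)) of S. If u is constant along the fibres of B x W -> W, then it factors through W
  without any descent: the section psi(b, u(b, w)) over B x W gives a morphism W -> X, and it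
  pulls back to u because psi(b', u(b, w)) = psi(b', u(b', w)) over B x B x W.

  For a 2-relative cluster family theta this writes q1 o theta as a morphism x : W -> X, while the
  component of theta in S is the family of sections given by some y : W -> X. Then psi0 o (Id x (x, y))
  is the composition of theta with the blow up morphism, so (x, y) lifts to f : W -> X', and the
  uniqueness in the universal property of the blow up gives theta = b' o (Id x f).
*)

theory Submission
  imports Defs "HOL-Algebra.QuotRing"
begin

no_notation map_comp (infixl "\<circ>\<^sub>m" 55)

section \<open>The category of locally ringed spaces\<close>

lemma MorD:
  assumes "f \<in> Mor X Y"
  shows "Dom f = X" "Cod f = Y" "continuous_map (topo X) (topo Y) (pmap f)"
    "pmap f \<in> extensional (points X)" "smap f \<in> extensional (points X)"
    "\<And>x. x \<in> points X \<Longrightarrow> pmap f x \<in> points Y"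
    "\<And>x. x \<in> points X \<Longrightarrow> smap f x \<in> ring_hom (stalk Y (pmap f x)) (stalk X x)"
    "\<And>x. x \<in> points X \<Longrightarrow> smap f x \<in> extensional (carrier (stalk Y (pmap f x)))"
    "\<And>x a. x \<in> points X \<Longrightarrow> a \<in> carrier (stalk Y (pmap f x)) \<Longrightarrow>
      smap f x a \<in> Units (stalk X x) \<Longrightarrow> a \<in> Units (stalk Y (pmap f x))"
    "\<And>V s. openin (topo Y) V \<Longrightarrow> s \<in> sections Y V \<Longrightarrow>
      pullback_section f V s \<in> sections X {x \<in> points X. pmap f x \<in> V}"
  using assms continuous_map_image_subset_topspace[of "topo X" "topo Y" "pmap f"]
  by (auto simp: Mor_def)

lemma smap_closed:
  assumes "f \<in> Mor X Y" "x \<in> points X" "a \<in> carrier (stalk Y (pmap f x))"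
  shows "smap f x a \<in> carrier (stalk X x)"
  using ring_hom_closed[OF MorD(7)[OF assms(1,2)] assms(3)] .

text \<open>
  This is all that composition of morphisms requires of the target; for \<open>Spec R\<close> it is much
  easier to verify than \<open>ringed_space\<close>.
\<close>

definition closed_stalks :: "('p, 'g) ringed_space \<Rightarrow> bool" where
  "closed_stalks X \<longleftrightarrow>
    (\<forall>U s. openin (topo X) U \<longrightarrow> s \<in> sections X U \<longrightarrow> (\<forall>x\<in>U. s x \<in> carrier (stalk X x))) \<and>
    (\<forall>x\<in>points X. \<one>\<^bsub>stalk X x\<^esub> \<in> carrier (stalk X x) \<and>
      (\<forall>a\<in>carrier (stalk X x). \<forall>b\<in>carrier (stalk X x).
        a \<otimes>\<^bsub>stalk X x\<^esub> b \<in> carrier (stalk X x) \<and> a \<oplus>\<^bsub>stalk X x\<^esub> b \<in> carrier (stalk X x)))"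

lemma ringed_space_closed_stalks:
  assumes "ringed_space X"
  shows "closed_stalks X"
proof -
  have "s x \<in> carrier (stalk X x)" if "openin (topo X) U" "s \<in> sections X U" "x \<in> U" for U s x
  proof -
    have "sections X U \<subseteq> (\<Pi>\<^sub>E x\<in>U. carrier (stalk X x))"
      using assms that(1) by (simp add: ringed_space_def)
    then show ?thesis using that(2,3) by (auto dest: PiE_mem)
  qed
  moreover have "ring (stalk X x)" if "x \<in> points X" for x
    using assms that by (simp add: ringed_space_def cring.axioms(1))
  ultimately show ?thesis
    unfolding closed_stalks_def by (simp add: ring.ring_simprules)
qed

lemma scheme_ringed_space: "scheme X \<Longrightarrow> ringed_space X"
  by (simp add: scheme_def locally_ringed_space_def)

lemma scheme_closed_stalks: "scheme X \<Longrightarrow> closed_stalks X"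
  by (simp add: scheme_ringed_space ringed_space_closed_stalks)

section \<open>Fractions and the stalks of a spectrum\<close>

lemma fraction_eqI:
  assumes p: "primeideal p R" and D: "D = carrier R \<times> carrier R"
    and a: "a \<in> carrier R" "s \<in> carrier R" "s \<notin> p"
    and b: "b \<in> carrier R" "t \<in> carrier R" "t \<notin> p"
    and u: "u \<in> carrier R" "u \<notin> p" and eq: "u \<otimes>\<^bsub>R\<^esub> (a \<otimes>\<^bsub>R\<^esub> t) = u \<otimes>\<^bsub>R\<^esub> (b \<otimes>\<^bsub>R\<^esub> s)"
  shows "fraction R D p a s = fraction R D p b t"
proof -
  interpret primeideal p R by fact
  have np: "x \<otimes>\<^bsub>R\<^esub> y \<notin> p" if "x \<in> carrier R" "y \<in> carrier R" "x \<notin> p" "y \<notin> p" for x y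
    using I_prime that by blast
  have sub: "fraction R D p b t \<subseteq> fraction R D p a s"
    if a: "a \<in> carrier R" "s \<in> carrier R" "s \<notin> p"
      and b: "b \<in> carrier R" "t \<in> carrier R" "t \<notin> p"
      and eq: "u \<otimes>\<^bsub>R\<^esub> (a \<otimes>\<^bsub>R\<^esub> t) = u \<otimes>\<^bsub>R\<^esub> (b \<otimes>\<^bsub>R\<^esub> s)" for a s b t
  proof
    fix z assume "z \<in> fraction R D p b t"
    then obtain c w v where z: "z = (c, w)" and c: "c \<in> carrier R" "w \<in> carrier R" "w \<notin> p"
      and v: "v \<in> carrier R" "v \<notin> p" and eq': "v \<otimes>\<^bsub>R\<^esub> (b \<otimes>\<^bsub>R\<^esub> w) = v \<otimes>\<^bsub>R\<^esub> (c \<otimes>\<^bsub>R\<^esub> t)"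
      by (auto simp: fraction_def D)
    \<comment> \<open>Transitivity of the relation between pairs: \<open>u\<close> witnesses a/s =
      b/t and \<open>v\<close> witnesses b/t = c/w. The extra factor \<open>t\<close>, the
      denominator in the middle, lets both identities be applied; as \<open>p\<close> is prime, the
      product stays outside \<open>p\<close>.\<close>
    let ?k = "u \<otimes>\<^bsub>R\<^esub> (v \<otimes>\<^bsub>R\<^esub> t)"
    have "?k \<otimes>\<^bsub>R\<^esub> (a \<otimes>\<^bsub>R\<^esub> w) = (v \<otimes>\<^bsub>R\<^esub> w) \<otimes>\<^bsub>R\<^esub> (u \<otimes>\<^bsub>R\<^esub> (a \<otimes>\<^bsub>R\<^esub> t))"
      using a b c u v by (simp add: m_ac)
    also have "\<dots> = (u \<otimes>\<^bsub>R\<^esub> s) \<otimes>\<^bsub>R\<^esub> (v \<otimes>\<^bsub>R\<^esub> (b \<otimes>\<^bsub>R\<^esub> w))"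
      unfolding eq using a b c u v by (simp add: m_ac)
    also have "\<dots> = ?k \<otimes>\<^bsub>R\<^esub> (c \<otimes>\<^bsub>R\<^esub> s)"
      unfolding eq' using a b c u v by (simp add: m_ac)
    finally show "z \<in> fraction R D p a s"
      using z c a b u v by (auto simp: fraction_def D np intro!: exI[of _ ?k])
  qed
  show ?thesis using sub[OF a b eq] sub[OF b a eq[symmetric]] by blast
qed

lemma fraction_in_localization:
  "(a, s) \<in> D \<Longrightarrow> s \<notin> p \<Longrightarrow> fraction R D p a s \<in> carrier (localization R D p)"
  by (auto simp: localization_def)

text \<open>The operations are unions over all representatives. Every member of such a union is the
  same class, so the union is the class computed from any chosen pair of representatives.\<close>

lemma localization_closed:
  assumes p: "primeideal p R" and D: "D = carrier R \<times> carrier R"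
    and A: "A \<in> carrier (localization R D p)" and C: "C \<in> carrier (localization R D p)"
  shows "A \<otimes>\<^bsub>localization R D p\<^esub> C \<in> carrier (localization R D p)"
    and "A \<oplus>\<^bsub>localization R D p\<^esub> C \<in> carrier (localization R D p)"
proof -
  interpret primeideal p R by fact
  have np: "x \<otimes>\<^bsub>R\<^esub> y \<notin> p" if "x \<in> carrier R" "y \<in> carrier R" "x \<notin> p" "y \<notin> p" for x y
    using I_prime that by blast
  have np1: "\<one>\<^bsub>R\<^esub> \<notin> p" using one_imp_carrier I_notcarr by blast
  obtain a s where a: "a \<in> carrier R" "s \<in> carrier R" "s \<notin> p" and Aeq: "A = fraction R D p a s"
    using A by (auto simp: localization_def D)
  obtain c t where c: "c \<in> carrier R" "t \<in> carrier R" "t \<notin> p" and Ceq: "C = fraction R D p c t"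
    using C by (auto simp: localization_def D)
  \<comment> \<open>A pair represents its own fraction. This keeps the unions below from being
    empty, so that a union of a constant family equals that constant.\<close>
  have ne: "(a, s) \<in> A" "(c, t) \<in> C"
    using a c np1 by (auto simp: Aeq Ceq fraction_def D)
  have same: "fraction R D p (a' \<otimes>\<^bsub>R\<^esub> c') (s' \<otimes>\<^bsub>R\<^esub> t') = fraction R D p (a \<otimes>\<^bsub>R\<^esub> c) (s \<otimes>\<^bsub>R\<^esub> t) \<and>
      fraction R D p ((a' \<otimes>\<^bsub>R\<^esub> t') \<oplus>\<^bsub>R\<^esub> (c' \<otimes>\<^bsub>R\<^esub> s')) (s' \<otimes>\<^bsub>R\<^esub> t') =
      fraction R D p ((a \<otimes>\<^bsub>R\<^esub> t) \<oplus>\<^bsub>R\<^esub> (c \<otimes>\<^bsub>R\<^esub> s)) (s \<otimes>\<^bsub>R\<^esub> t)"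
    if mem: "(a', s') \<in> A" "(c', t') \<in> C" for a' s' c' t'
  proof -
    from mem(1) obtain u where a': "a' \<in> carrier R" "s' \<in> carrier R" "s' \<notin> p"
      and u: "u \<in> carrier R" "u \<notin> p" and eq: "u \<otimes>\<^bsub>R\<^esub> (a \<otimes>\<^bsub>R\<^esub> s') = u \<otimes>\<^bsub>R\<^esub> (a' \<otimes>\<^bsub>R\<^esub> s)"
      by (auto simp: Aeq fraction_def D)
    from mem(2) obtain v where c': "c' \<in> carrier R" "t' \<in> carrier R" "t' \<notin> p"
      and v: "v \<in> carrier R" "v \<notin> p" and eq': "v \<otimes>\<^bsub>R\<^esub> (c \<otimes>\<^bsub>R\<^esub> t') = v \<otimes>\<^bsub>R\<^esub> (c' \<otimes>\<^bsub>R\<^esub> t)"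
      by (auto simp: Ceq fraction_def D)
    note mem = a a' c c' u v
    let ?k = "u \<otimes>\<^bsub>R\<^esub> v"
    have "?k \<otimes>\<^bsub>R\<^esub> ((a' \<otimes>\<^bsub>R\<^esub> c') \<otimes>\<^bsub>R\<^esub> (s \<otimes>\<^bsub>R\<^esub> t)) =
        (u \<otimes>\<^bsub>R\<^esub> (a' \<otimes>\<^bsub>R\<^esub> s)) \<otimes>\<^bsub>R\<^esub> (v \<otimes>\<^bsub>R\<^esub> (c' \<otimes>\<^bsub>R\<^esub> t))"
      using mem by (simp add: m_ac)
    also have "\<dots> = ?k \<otimes>\<^bsub>R\<^esub> ((a \<otimes>\<^bsub>R\<^esub> c) \<otimes>\<^bsub>R\<^esub> (s' \<otimes>\<^bsub>R\<^esub> t'))"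
      unfolding eq[symmetric] eq'[symmetric] using mem by (simp add: m_ac)
    finally have m: "?k \<otimes>\<^bsub>R\<^esub> ((a' \<otimes>\<^bsub>R\<^esub> c') \<otimes>\<^bsub>R\<^esub> (s \<otimes>\<^bsub>R\<^esub> t)) =
      ?k \<otimes>\<^bsub>R\<^esub> ((a \<otimes>\<^bsub>R\<^esub> c) \<otimes>\<^bsub>R\<^esub> (s' \<otimes>\<^bsub>R\<^esub> t'))" .
    have "?k \<otimes>\<^bsub>R\<^esub> (((a' \<otimes>\<^bsub>R\<^esub> t') \<oplus>\<^bsub>R\<^esub> (c' \<otimes>\<^bsub>R\<^esub> s')) \<otimes>\<^bsub>R\<^esub> (s \<otimes>\<^bsub>R\<^esub> t)) =
        (u \<otimes>\<^bsub>R\<^esub> (a' \<otimes>\<^bsub>R\<^esub> s)) \<otimes>\<^bsub>R\<^esub> (v \<otimes>\<^bsub>R\<^esub> (t \<otimes>\<^bsub>R\<^esub> t')) \<oplus>\<^bsub>R\<^esub>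
        (v \<otimes>\<^bsub>R\<^esub> (c' \<otimes>\<^bsub>R\<^esub> t)) \<otimes>\<^bsub>R\<^esub> (u \<otimes>\<^bsub>R\<^esub> (s \<otimes>\<^bsub>R\<^esub> s'))"
      using mem by (simp add: m_ac l_distr r_distr)
    also have "\<dots> = ?k \<otimes>\<^bsub>R\<^esub> (((a \<otimes>\<^bsub>R\<^esub> t) \<oplus>\<^bsub>R\<^esub> (c \<otimes>\<^bsub>R\<^esub> s)) \<otimes>\<^bsub>R\<^esub> (s' \<otimes>\<^bsub>R\<^esub> t'))"
      unfolding eq[symmetric] eq'[symmetric] using mem by (simp add: m_ac l_distr r_distr)
    finally show ?thesis
      using m mem by (intro conjI fraction_eqI[OF p D, of _ _ _ _ ?k]) (simp_all add: np)
  qed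
  have UN: "(\<Union>(x, y)\<in>A. \<Union>(z, w)\<in>C. F x y z w) = k"
    if "\<And>x y z w. (x, y) \<in> A \<Longrightarrow> (z, w) \<in> C \<Longrightarrow> F x y z w = k" for F and k :: "('a \<times> 'a) set"
    using that ne by (intro SUP_eq_const) auto
  have "A \<otimes>\<^bsub>localization R D p\<^esub> C = fraction R D p (a \<otimes>\<^bsub>R\<^esub> c) (s \<otimes>\<^bsub>R\<^esub> t)"
    unfolding localization_def by (simp, rule UN) (simp add: same)
  moreover have "A \<oplus>\<^bsub>localization R D p\<^esub> C =
      fraction R D p ((a \<otimes>\<^bsub>R\<^esub> t) \<oplus>\<^bsub>R\<^esub> (c \<otimes>\<^bsub>R\<^esub> s)) (s \<otimes>\<^bsub>R\<^esub> t)"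
    unfolding localization_def by (simp, rule UN) (simp add: same)
  ultimately show "A \<otimes>\<^bsub>localization R D p\<^esub> C \<in> carrier (localization R D p)"
    "A \<oplus>\<^bsub>localization R D p\<^esub> C \<in> carrier (localization R D p)"
    using a c np by (auto simp: D intro!: fraction_in_localization)
qed

text \<open>Structure morphisms end in a spectrum, so this is what allows composing them with other
  morphisms.\<close>

lemma Spec_closed_stalks: "closed_stalks (Spec R)"
proof -
  have "primeideal p R" if "p \<in> points (Spec R)" for p
  proof -
    \<comment> \<open>\<open>topology\<close> returns the prescribed open sets only once they are
      known to form a topology. Then every point lies in an open set, and open sets consist of
      primes.\<close>
    have "openin (zariski R {p. primeideal p R}) = (\<lambda>U. \<exists>A \<subseteq> carrier R. U = {p \<in> {p. primeideal p R}. \<not> A \<subseteq> p})"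
      unfolding zariski_def by (intro topology_inverse' istopology_zariski) simp
    then show ?thesis
      using that by (auto simp: Spec_def fraction_space_def topspace_def)
  qed
  moreover have "\<one>\<^bsub>localization R (carrier R \<times> carrier R) p\<^esub>
      \<in> carrier (localization R (carrier R \<times> carrier R) p)" if "primeideal p R" for p
  proof -
    interpret primeideal p R by fact
    have "\<one>\<^bsub>R\<^esub> \<notin> p" using one_imp_carrier I_notcarr by blast
    then show ?thesis
      using fraction_in_localization[of "\<one>\<^bsub>R\<^esub>" "\<one>\<^bsub>R\<^esub>" "carrier R \<times> carrier R" p R]
      by (simp add: localization_def)
  qed
  ultimately show ?thesis
    by (auto simp: closed_stalks_def Spec_def fraction_space_def localization_closed dest: PiE_mem)
qed

section \<open>Composition of morphisms\<close>

lemma restrict_ring_hom: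
  assumes h: "h \<in> ring_hom R T" and "\<one>\<^bsub>R\<^esub> \<in> carrier R"
    and "\<And>a b. a \<in> carrier R \<Longrightarrow> b \<in> carrier R \<Longrightarrow>
      a \<otimes>\<^bsub>R\<^esub> b \<in> carrier R \<and> a \<oplus>\<^bsub>R\<^esub> b \<in> carrier R"
  shows "restrict h (carrier R) \<in> ring_hom R T"
  using assms by (auto simp: ring_hom_def)

text \<open>Pulling a section back along the composite is pulling it back twice.
  \<open>mcomp\<close> cuts the stalk maps down to the carriers; closure of the stalks of
  \<open>Z\<close> keeps them ring homomorphisms.\<close>

lemma mcomp_in_Mor:
  assumes f: "f \<in> Mor X Y" and g: "g \<in> Mor Y Z" and Z: "closed_stalks Z"
  shows "g \<circ>\<^sub>m f \<in> Mor X Z"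
proof -
  note F = MorD[OF f] and G = MorD[OF g]
  have cont: "continuous_map (topo X) (topo Z) (\<lambda>x\<in>points X. pmap g (pmap f x))"
    using continuous_map_compose[OF F(3) G(3)] by (rule continuous_map_eq) simp
  have pull: "pullback_section (g \<circ>\<^sub>m f) V s
      \<in> sections X {x \<in> points X. pmap (g \<circ>\<^sub>m f) x \<in> V}"
    if V: "openin (topo Z) V" "s \<in> sections Z V" for V s
  proof -
    let ?V = "{y \<in> points Y. pmap g y \<in> V}"
    have "openin (topo Y) ?V" using openin_continuous_map_preimage[OF G(3) V(1)] .
    then have "pullback_section f ?V (pullback_section g V s) \<in> sections X {x \<in> points X. pmap f x \<in> ?V}"
      by (rule F(10)) (rule G(10)[OF V])
    moreover have dom: "{x \<in> points X. pmap f x \<in> ?V} = {x \<in> points X. pmap (g \<circ>\<^sub>m f) x \<in> V}"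
      using F(6) by (auto simp: mcomp_def F(1))
    moreover have "pullback_section (g \<circ>\<^sub>m f) V s = pullback_section f ?V (pullback_section g V s)"
    proof
      fix x
      \<comment> \<open>Sections take values in the stalks, so cutting the stalk maps down to the
        carriers does not affect the pulled back section.\<close>
      have "s y \<in> carrier (stalk Z y)" if "y \<in> V" for y
        using Z V that unfolding closed_stalks_def by blast
      then show "pullback_section (g \<circ>\<^sub>m f) V s x = pullback_section f ?V (pullback_section g V s) x"
        using F(6) by (auto simp: pullback_section_def mcomp_def F(1) G(1,2))
    qed
    ultimately show ?thesis by simp
  qed
  have "smap (g \<circ>\<^sub>m f) x \<in> ring_hom (stalk Z (pmap (g \<circ>\<^sub>m f) x)) (stalk X x)" if x: "x \<in> points X" for x
    using restrict_ring_hom[OF ring_hom_trans[OF G(7)[OF F(6)[OF x]] F(7)[OF x]]] x Z G(6)[OF F(6)[OF x]]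
    by (simp add: mcomp_def F(1) G(2) closed_stalks_def restrict_def cong: if_cong)
  then show ?thesis
    using cont pull F(6,9) G(9) smap_closed[OF g]
    by (auto simp: Mor_def mcomp_def F(1,2) G(1,2))
qed

text \<open>The stalk map of \<open>g \<circ>\<^sub>m f\<close> is cut down to the stalk of
  \<open>Z\<close>; the stalk map of \<open>h\<close> takes its values there, so both bracketings
  agree as records.\<close>

lemma mcomp_assoc:
  assumes "f \<in> Mor X Y" "g \<in> Mor Y Z" "h \<in> Mor Z T"
  shows "h \<circ>\<^sub>m g \<circ>\<^sub>m f = h \<circ>\<^sub>m (g \<circ>\<^sub>m f)"
  using MorD(1,2,6)[OF assms(1)] MorD(1,2,6)[OF assms(2)] MorD(1,2,6)[OF assms(3)]
    smap_closed[OF assms(3)]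
  by (auto simp: mcomp_def restrict_def fun_eq_iff)

lemma idm_mcomp:
  assumes "f \<in> Mor X Y"
  shows "idm Y \<circ>\<^sub>m f = f"
proof -
  note F = MorD[OF assms]
  have "smap f x a = undefined" if "x \<in> points X" "a \<notin> carrier (stalk Y (pmap f x))" for x a
    using F(8)[OF that(1)] that(2) by (rule extensional_arb)
  moreover have "pmap f x = undefined" "smap f x = undefined" if "x \<notin> points X" for x
    using F(4,5) that by (auto intro: extensional_arb)
  ultimately show ?thesis
    using F(1,2,6)
    by (intro morphism.equality) (auto simp: mcomp_def idm_def fun_eq_iff)
qed

section \<open>Schemes and morphisms over the base field\<close>

lemma KMorD:
  assumes "f \<in> KMor X Y"
  shows "f \<in> Mor (Dom X) (Dom Y)" "Y \<circ>\<^sub>m f = X"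
  using assms by (auto simp: KMor_def)

lemma kschemeD:
  assumes "kscheme K X"
  shows "scheme (Dom X)" "closed_stalks (Dom X)" "X \<in> Mor (Dom X) (Spec K)"
  using assms by (auto simp: kscheme_def scheme_closed_stalks)

lemma mcomp_in_KMor:
  assumes f: "f \<in> KMor X Y" and g: "g \<in> KMor Y Z" and Z: "kscheme K Z"
  shows "g \<circ>\<^sub>m f \<in> KMor X Z"
  using mcomp_in_Mor[OF KMorD(1)[OF f] KMorD(1)[OF g] kschemeD(2)[OF Z]]
    mcomp_assoc[OF KMorD(1)[OF f] KMorD(1)[OF g] kschemeD(3)[OF Z]] KMorD(2)[OF f] KMorD(2)[OF g]
  by (simp add: KMor_def)


section \<open>Inverse images of ideals\<close>

lemma genideal_image_genideal:
  assumes R: "cring R" and T: "cring T" and h: "h \<in> ring_hom R T" and A: "A \<subseteq> carrier R"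
  shows "genideal T (h ` genideal R A) = genideal T (h ` A)"
proof -
  interpret R: cring R by fact
  interpret T: cring T by fact
  interpret ring_hom_ring R T h
    by (rule ring_hom_ringI2[OF R.ring_axioms T.ring_axioms h])
  have hA: "h ` A \<subseteq> carrier T" using A by auto
  have "ideal {r \<in> carrier R. h r \<in> genideal T (h ` A)} R"
    by (rule ideal_vimage[OF T.genideal_ideal[OF hA]])
  moreover have "A \<subseteq> {r \<in> carrier R. h r \<in> genideal T (h ` A)}"
    using A T.genideal_self[OF hA] by auto
  ultimately have "genideal R A \<subseteq> {r \<in> carrier R. h r \<in> genideal T (h ` A)}"
    by (rule R.genideal_minimal)
  then have "h ` genideal R A \<subseteq> genideal T (h ` A)" by auto
  moreover have "h ` A \<subseteq> genideal T (h ` genideal R A)"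
  proof -
    have "genideal R A \<subseteq> carrier R" using ideal.Icarr[OF R.genideal_ideal[OF A]] by blast
    then have "h ` genideal R A \<subseteq> genideal T (h ` genideal R A)" by (intro T.genideal_self) auto
    then show ?thesis using R.genideal_self[OF A] by blast
  qed
  moreover have "ideal (genideal T (h ` A)) T" "ideal (genideal T (h ` genideal R A)) T"
    using hA ideal.Icarr[OF R.genideal_ideal[OF A]] by (auto intro!: T.genideal_ideal)
  ultimately show ?thesis by (meson T.genideal_minimal subset_antisym)
qed

text \<open>At each stalk this is \<open>genideal_image_genideal\<close>. The bound on
  \<open>I\<close> keeps its elements in the range where the stalk maps of the composite are
  defined.\<close>

lemma inverse_image_ideal_mcomp:
  assumes f: "f \<in> Mor X Y" and g: "g \<in> Mor Y Z"
    and X: "ringed_space X" and Y: "ringed_space Y"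
    and I: "\<And>z. z \<in> points Z \<Longrightarrow> I z \<subseteq> carrier (stalk Z z)"
  shows "inverse_image_ideal (g \<circ>\<^sub>m f) I = inverse_image_ideal f (inverse_image_ideal g I)"
proof
  fix x
  note F = MorD[OF f] and G = MorD[OF g]
  show "inverse_image_ideal (g \<circ>\<^sub>m f) I x = inverse_image_ideal f (inverse_image_ideal g I) x"
  proof (cases "x \<in> points X")
    case True
    let ?y = "pmap f x"
    note y = F(6)[OF True]
    have sub: "smap g ?y ` I (pmap g ?y) \<subseteq> carrier (stalk Y ?y)"
      using smap_closed[OF g y] I[OF G(6)[OF y]] by auto
    have "smap (g \<circ>\<^sub>m f) x ` I (pmap g ?y) = smap f x ` smap g ?y ` I (pmap g ?y)"
      using True I[OF G(6)[OF y]] by (auto simp: mcomp_def F(1) G(2) image_iff subset_iff)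
    moreover have "cring (stalk X x)" "cring (stalk Y ?y)"
      using X Y True y by (auto simp: ringed_space_def)
    ultimately show ?thesis
      using True y genideal_image_genideal[OF _ _ F(7)[OF True] sub]
      by (simp add: inverse_image_ideal_def mcomp_def F(1) G(1))
  qed (simp add: inverse_image_ideal_def mcomp_def F(1))
qed

lemma image_ideal_subset_stalk:
  assumes "closed_stalks (Cod f)" "y \<in> points (Cod f)"
  shows "image_ideal f y \<subseteq> carrier (stalk (Cod f) y)"
  using assms by (auto simp: image_ideal_def closed_stalks_def)


section \<open>Products\<close>

lemma fibre_productD:
  fixes c :: "('p, 'g, 'p, 'g, 'p, 'g) cone"
  assumes "fibre_product f g c"
  shows "scheme (Apex c)" "fst c \<in> Mor (Apex c) (Dom f)" "snd c \<in> Mor (Apex c) (Dom g)"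
    "f \<circ>\<^sub>m fst c = g \<circ>\<^sub>m snd c"
    "\<And>(T :: ('p, 'g) ringed_space) a b. a \<in> Mor T (Dom f) \<Longrightarrow> b \<in> Mor T (Dom g) \<Longrightarrow> scheme T \<Longrightarrow>
      f \<circ>\<^sub>m a = g \<circ>\<^sub>m b \<Longrightarrow> \<exists>!h. h \<in> Mor T (Apex c) \<and> fst c \<circ>\<^sub>m h = a \<and> snd c \<circ>\<^sub>m h = b"
  using assms by (simp_all add: fibre_product_def)

lemma pair_mor:
  fixes c :: "('p, 'g, 'p, 'g, 'p, 'g) cone" and T :: "('p, 'g) ringed_space"
  assumes c: "fibre_product f g c" and T: "scheme T"
    and a: "a \<in> Mor T (Dom f)" and b: "b \<in> Mor T (Dom g)" and eq: "f \<circ>\<^sub>m a = g \<circ>\<^sub>m b"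
  shows "pair_mor c a b \<in> Mor T (Apex c)"
    "fst c \<circ>\<^sub>m pair_mor c a b = a" "snd c \<circ>\<^sub>m pair_mor c a b = b"
proof -
  show "pair_mor c a b \<in> Mor T (Apex c)"
    "fst c \<circ>\<^sub>m pair_mor c a b = a" "snd c \<circ>\<^sub>m pair_mor c a b = b"
    using theI'[OF fibre_productD(5)[OF c a b T eq]]
    by (simp_all add: pair_mor_def MorD(1)[OF a])
qed

lemma ex1_eq: "\<exists>!x. P x \<Longrightarrow> P a \<Longrightarrow> P b \<Longrightarrow> a = b"
  by blast

text \<open>Composing the square of \<open>c\<close> with \<open>h\<close> shows that the components
  of \<open>h\<close> are compatible, so the uniqueness half of the universal property applies. The
  common target \<open>Q\<close> enters through associativity.\<close>

lemma fibre_product_eqI: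
  fixes c :: "('p, 'g, 'p, 'g, 'p, 'g) cone" and T :: "('p, 'g) ringed_space"
  assumes f: "f \<in> Mor (Dom f) Q" and g: "g \<in> Mor (Dom g) Q" and sch: "scheme (Dom f)" "scheme (Dom g)"
    and c: "fibre_product f g c" and T: "scheme T"
    and h: "h \<in> Mor T (Apex c)" "h' \<in> Mor T (Apex c)"
    and eq: "fst c \<circ>\<^sub>m h = fst c \<circ>\<^sub>m h'" "snd c \<circ>\<^sub>m h = snd c \<circ>\<^sub>m h'"
  shows "h = h'"
proof -
  note C = fibre_productD[OF c]
  have a: "fst c \<circ>\<^sub>m h \<in> Mor T (Dom f)" and b: "snd c \<circ>\<^sub>m h \<in> Mor T (Dom g)"
    using mcomp_in_Mor[OF h(1) C(2)] mcomp_in_Mor[OF h(1) C(3)] sch by (simp_all add: scheme_closed_stalks)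
  have "f \<circ>\<^sub>m (fst c \<circ>\<^sub>m h) = g \<circ>\<^sub>m (snd c \<circ>\<^sub>m h)"
    unfolding mcomp_assoc[OF h(1) C(2) f, symmetric] mcomp_assoc[OF h(1) C(3) g, symmetric] C(4) ..
  from C(5)[OF a b T this] show ?thesis
    by (rule ex1_eq) (simp_all only: h eq)
qed

lemma pair_mor_unique:
  fixes c :: "('p, 'g, 'p, 'g, 'p, 'g) cone" and T :: "('p, 'g) ringed_space"
  assumes f: "f \<in> Mor (Dom f) Q" and g: "g \<in> Mor (Dom g) Q" and sch: "scheme (Dom f)" "scheme (Dom g)"
    and c: "fibre_product f g c" and T: "scheme T" and h: "h \<in> Mor T (Apex c)"
    and eq: "fst c \<circ>\<^sub>m h = a" "snd c \<circ>\<^sub>m h = b"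
  shows "pair_mor c a b = h"
proof -
  note C = fibre_productD[OF c]
  have a: "a \<in> Mor T (Dom f)" and b: "b \<in> Mor T (Dom g)"
    using mcomp_in_Mor[OF h C(2)] mcomp_in_Mor[OF h C(3)] sch eq by (simp_all add: scheme_closed_stalks)
  moreover have "f \<circ>\<^sub>m a = g \<circ>\<^sub>m b"
    using mcomp_assoc[OF h C(2) f] mcomp_assoc[OF h C(3) g] C(4) eq by simp
  ultimately show ?thesis
    using pair_mor[OF c T a b] eq h by - (rule fibre_product_eqI[OF f g sch c T], simp_all)
qed

lemma pair_mor_mcomp:
  fixes c :: "('p, 'g, 'p, 'g, 'p, 'g) cone" and T T' :: "('p, 'g) ringed_space"
  assumes f: "f \<in> Mor (Dom f) Q" and g: "g \<in> Mor (Dom g) Q" and sch: "scheme (Dom f)" "scheme (Dom g)"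
    and c: "fibre_product f g c" and T: "scheme T" "scheme T'"
    and a: "a \<in> Mor T (Dom f)" and b: "b \<in> Mor T (Dom g)" and eq: "f \<circ>\<^sub>m a = g \<circ>\<^sub>m b"
    and h: "h \<in> Mor T' T"
  shows "pair_mor c a b \<circ>\<^sub>m h = pair_mor c (a \<circ>\<^sub>m h) (b \<circ>\<^sub>m h)"
proof -
  note C = fibre_productD[OF c] and P = pair_mor[OF c T(1) a b eq]
  have "pair_mor c a b \<circ>\<^sub>m h \<in> Mor T' (Apex c)"
    using mcomp_in_Mor[OF h P(1)] scheme_closed_stalks[OF C(1)] .
  then show ?thesis
    using mcomp_assoc[OF h P(1) C(2)] mcomp_assoc[OF h P(1) C(3)] P(2,3)
    by - (rule pair_mor_unique[OF f g sch c T(2), symmetric], simp_all)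
qed

lemma Dom_mcomp [simp]: "Dom (g \<circ>\<^sub>m f) = Dom f" and Cod_mcomp [simp]: "Cod (g \<circ>\<^sub>m f) = Cod g"
  by (simp_all add: mcomp_def)

lemma fibre_product_kscheme:
  assumes c: "fibre_product X g c" and X: "kscheme K X"
  shows "kscheme K (X \<circ>\<^sub>m fst c)"
  using fibre_productD(1)[OF c] mcomp_in_Mor[OF fibre_productD(2)[OF c] kschemeD(3)[OF X] Spec_closed_stalks]
  by (simp add: kscheme_def)

lemma prod_mor_idm:
  fixes BV BW :: "('p, 'g, 'p, 'g, 'p, 'g) cone"
  assumes B: "kscheme K B" and V: "kscheme K V" and W: "kscheme K W"
    and BV: "fibre_product B V BV" and BW: "fibre_product B W BW" and f: "f \<in> KMor V W"
  shows "prod_mor BV BW (idm (Dom B)) f = pair_mor BW (fst BV) (f \<circ>\<^sub>m snd BV)"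
    "prod_mor BV BW (idm (Dom B)) f \<in> Mor (Apex BV) (Apex BW)"
    "fst BW \<circ>\<^sub>m prod_mor BV BW (idm (Dom B)) f = fst BV"
    "snd BW \<circ>\<^sub>m prod_mor BV BW (idm (Dom B)) f = f \<circ>\<^sub>m snd BV"
proof -
  note v = fibre_productD[OF BV] and f = KMorD[OF f]
  show eq: "prod_mor BV BW (idm (Dom B)) f = pair_mor BW (fst BV) (f \<circ>\<^sub>m snd BV)"
    by (simp add: prod_mor_def idm_mcomp[OF v(2)])
  have "f \<circ>\<^sub>m snd BV \<in> Mor (Apex BV) (Dom W)"
    using mcomp_in_Mor[OF v(3) f(1) kschemeD(2)[OF W]] .
  moreover have "B \<circ>\<^sub>m fst BV = W \<circ>\<^sub>m (f \<circ>\<^sub>m snd BV)"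
    using mcomp_assoc[OF v(3) f(1) kschemeD(3)[OF W]] v(4) f(2) by simp
  ultimately show "prod_mor BV BW (idm (Dom B)) f \<in> Mor (Apex BV) (Apex BW)"
    "fst BW \<circ>\<^sub>m prod_mor BV BW (idm (Dom B)) f = fst BV"
    "snd BW \<circ>\<^sub>m prod_mor BV BW (idm (Dom B)) f = f \<circ>\<^sub>m snd BV"
    unfolding eq using pair_mor[OF BW v(1,2)] by auto
qed

text \<open>Functoriality of the product with B: both sides have the same two components.\<close>

lemma prod_mor_idm_mcomp:
  fixes BU BV BW :: "('p, 'g, 'p, 'g, 'p, 'g) cone"
  assumes B: "kscheme K B" and U: "kscheme K U" and V: "kscheme K V" and W: "kscheme K W"
    and BU: "fibre_product B U BU" and BV: "fibre_product B V BV" and BW: "fibre_product B W BW"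
    and f: "f \<in> KMor U V" and g: "g \<in> KMor V W"
  shows "prod_mor BV BW (idm (Dom B)) g \<circ>\<^sub>m prod_mor BU BV (idm (Dom B)) f =
    prod_mor BU BW (idm (Dom B)) (g \<circ>\<^sub>m f)"
proof -
  note F = prod_mor_idm[OF B U V BU BV f] and G = prod_mor_idm[OF B V W BV BW g]
  note H = prod_mor_idm[OF B U W BU BW mcomp_in_KMor[OF f g W]]
  note u = fibre_productD[OF BU] and v = fibre_productD[OF BV] and w = fibre_productD[OF BW]
  have "prod_mor BV BW (idm (Dom B)) g \<circ>\<^sub>m prod_mor BU BV (idm (Dom B)) f \<in> Mor (Apex BU) (Apex BW)"
    using mcomp_in_Mor[OF F(2) G(2) scheme_closed_stalks[OF w(1)]] .
  moreover have "fst BW \<circ>\<^sub>m (prod_mor BV BW (idm (Dom B)) g \<circ>\<^sub>m prod_mor BU BV (idm (Dom B)) f) = fst BU"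
    using mcomp_assoc[OF F(2) G(2) w(2)] G(3) F(3) by simp
  moreover have "snd BW \<circ>\<^sub>m (prod_mor BV BW (idm (Dom B)) g \<circ>\<^sub>m prod_mor BU BV (idm (Dom B)) f) =
      g \<circ>\<^sub>m f \<circ>\<^sub>m snd BU"
    using mcomp_assoc[OF F(2) G(2) w(3)] G(4) F(4) mcomp_assoc[OF F(2) v(3) KMorD(1)[OF g]]
      mcomp_assoc[OF u(3) KMorD(1)[OF f] KMorD(1)[OF g]] by simp
  ultimately show ?thesis
    unfolding H(1)
    by (rule pair_mor_unique[OF kschemeD(3)[OF B] kschemeD(3)[OF W] kschemeD(1)[OF B] kschemeD(1)[OF W]
      BW u(1), symmetric])
qed

text \<open>\<open>B \<times> (B \<times> W) = (B \<times> W) \<times>\<^sub>W (B \<times> W)\<close>\<close>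

lemma fibre_product_self_product:
  fixes BW c :: "('p, 'g, 'p, 'g, 'p, 'g) cone"
  assumes B: "kscheme K B" and W: "kscheme K W" and BW: "fibre_product B W BW"
    and c: "fibre_product (snd BW) (snd BW) c"
  shows "fibre_product B (B \<circ>\<^sub>m fst BW) (fst BW \<circ>\<^sub>m fst c, snd c)"
proof -
  note w = fibre_productD[OF BW] and mB = kschemeD(3)[OF B] and mW = kschemeD(3)[OF W]
  have D: "Dom (snd BW) = Apex BW" using MorD(1)[OF w(3)] .
  note C = fibre_productD[OF c, unfolded D]
  have swap: "B \<circ>\<^sub>m (fst BW \<circ>\<^sub>m h) = W \<circ>\<^sub>m (snd BW \<circ>\<^sub>m h)"
    if "h \<in> Mor T (Apex BW)" for T :: "('p, 'g) ringed_space" and h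
    using mcomp_assoc[OF that w(2) mB] mcomp_assoc[OF that w(3) mW] w(4) by simp
  have "B \<circ>\<^sub>m (fst BW \<circ>\<^sub>m fst c) = B \<circ>\<^sub>m fst BW \<circ>\<^sub>m snd c"
    using swap[OF C(2)] swap[OF C(3)] C(4) mcomp_assoc[OF C(3) w(2) mB] by simp
  moreover have "fst BW \<circ>\<^sub>m fst c \<in> Mor (Apex c) (Dom B)"
    using mcomp_in_Mor[OF C(2) w(2) kschemeD(2)[OF B]] .
  moreover have "\<exists>!h. h \<in> Mor T (Apex c) \<and> fst BW \<circ>\<^sub>m fst c \<circ>\<^sub>m h = a \<and> snd c \<circ>\<^sub>m h = b"
    if T: "scheme T" and a: "a \<in> Mor T (Dom B)" and b: "b \<in> Mor T (Apex BW)"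
      and eq: "B \<circ>\<^sub>m a = B \<circ>\<^sub>m fst BW \<circ>\<^sub>m b" for T :: "('p, 'g) ringed_space" and a b
  proof -
    have sb: "snd BW \<circ>\<^sub>m b \<in> Mor T (Dom W)"
      using mcomp_in_Mor[OF b w(3) kschemeD(2)[OF W]] .
    have "B \<circ>\<^sub>m a = W \<circ>\<^sub>m (snd BW \<circ>\<^sub>m b)"
      using eq swap[OF b] mcomp_assoc[OF b w(2) mB] by simp
    note p = pair_mor[OF BW T a sb this]
    \<comment> \<open>A point (a, (b, w)) of B x (B x W) corresponds to the pair ((a, w), (b, w)),
      whose entries share the point w of W; \<open>?p\<close> is the first entry.\<close>
    let ?p = "pair_mor BW a (snd BW \<circ>\<^sub>m b)"
    note h = pair_mor[OF c T, unfolded D, OF p(1) b p(3)]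
    let ?h = "pair_mor c ?p b"
    have "fst BW \<circ>\<^sub>m fst c \<circ>\<^sub>m ?h = a"
      using mcomp_assoc[OF h(1) C(2) w(2)] h(2) p(2) by simp
    moreover have "h' = ?h"
      if h': "h' \<in> Mor T (Apex c)" "fst BW \<circ>\<^sub>m fst c \<circ>\<^sub>m h' = a" "snd c \<circ>\<^sub>m h' = b" for h'
    proof -
      have "fst c \<circ>\<^sub>m h' \<in> Mor T (Apex BW)"
        using mcomp_in_Mor[OF h'(1) C(2) scheme_closed_stalks[OF w(1)]] .
      moreover have "fst BW \<circ>\<^sub>m (fst c \<circ>\<^sub>m h') = a"
        using mcomp_assoc[OF h'(1) C(2) w(2)] h'(2) by simp
      moreover have "snd BW \<circ>\<^sub>m (fst c \<circ>\<^sub>m h') = snd BW \<circ>\<^sub>m b"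
        using mcomp_assoc[OF h'(1) C(2) w(3)] mcomp_assoc[OF h'(1) C(3) w(3)] C(4) h'(3) by simp
      ultimately have "?p = fst c \<circ>\<^sub>m h'"
        by (rule pair_mor_unique[OF mB mW kschemeD(1)[OF B] kschemeD(1)[OF W] BW T])
      then show ?thesis
        using pair_mor_unique[OF w(3)[folded D] w(3)[folded D] w(1)[folded D] w(1)[folded D] c T h'(1)
          _ h'(3), of ?p] by simp
    qed
    ultimately show ?thesis using h(1,3) by (intro ex1I[of _ ?h] conjI) (assumption | elim conjE)+
  qed
  ultimately show ?thesis
    unfolding fibre_product_def fst_conv snd_conv Dom_mcomp using C(1,3)
    by (intro conjI allI ballI impI)
qed


section \<open>Universal section families\<close>

text \<open>In this setting X represents the functor that sends V to the set of B-morphisms from B x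
  V to S.\<close>

locale universal_sections =
  fixes K :: "'k ring" and B S X :: "('u, 'u, 'k) kscheme"
    and BX :: "('u, 'u, 'u, 'u, 'u, 'u) cone" and \<pi> \<psi> :: "('u, 'u, 'u, 'u) morphism"
  assumes B: "kscheme K B" and S: "kscheme K S" and \<pi>: "\<pi> \<in> KMor S B"
    and universal: "universal_section_family K B \<pi> X BX \<psi>"
begin

lemma Dom_\<pi>: "Dom \<pi> = Dom S"
  using MorD(1)[OF KMorD(1)[OF \<pi>]] .

lemma X: "kscheme K X" and BX: "fibre_product B X BX"
  and \<psi>: "\<psi> \<in> Mor (Apex BX) (Dom S)" and \<pi>_\<psi>: "\<pi> \<circ>\<^sub>m \<psi> = fst BX"
  using universal by (auto simp: universal_section_family_def section_family_def Dom_\<pi>)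

text \<open>For T-valued points \<open>e\<close> of B and \<open>x\<close> of X over the base field,
  this is the T-valued point \<psi>(e, x) of S: the section \<open>x\<close> evaluated at
  \<open>e\<close>. It allows arguing with coordinates.\<close>

definition eval_section ::
    "('u, 'u, 'u, 'u) morphism \<Rightarrow> ('u, 'u, 'u, 'u) morphism \<Rightarrow> ('u, 'u, 'u, 'u) morphism" where
  "eval_section e x = \<psi> \<circ>\<^sub>m pair_mor BX e x"

lemma eval_section:
  fixes T T' :: "('u, 'u) ringed_space"
  assumes T: "scheme T" and e: "e \<in> Mor T (Dom B)" and x: "x \<in> Mor T (Dom X)"
    and eq: "B \<circ>\<^sub>m e = X \<circ>\<^sub>m x"
  shows "eval_section e x \<in> Mor T (Dom S)" "\<pi> \<circ>\<^sub>m eval_section e x = e"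
    "S \<circ>\<^sub>m eval_section e x = B \<circ>\<^sub>m e"
    "scheme T' \<Longrightarrow> h \<in> Mor T' T \<Longrightarrow>
      eval_section e x \<circ>\<^sub>m h = eval_section (e \<circ>\<^sub>m h) (x \<circ>\<^sub>m h)"
proof -
  note p = pair_mor[OF BX T e x eq]
  show ev: "eval_section e x \<in> Mor T (Dom S)"
    unfolding eval_section_def using mcomp_in_Mor[OF p(1) \<psi> kschemeD(2)[OF S]] .
  show eq': "\<pi> \<circ>\<^sub>m eval_section e x = e"
    unfolding eval_section_def using mcomp_assoc[OF p(1) \<psi> KMorD(1)[OF \<pi>]] p(2) \<pi>_\<psi> by simp
  show "S \<circ>\<^sub>m eval_section e x = B \<circ>\<^sub>m e"
    using mcomp_assoc[OF ev KMorD(1)[OF \<pi>] kschemeD(3)[OF B]] KMorD(2)[OF \<pi>] eq' by simp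
  show "eval_section e x \<circ>\<^sub>m h = eval_section (e \<circ>\<^sub>m h) (x \<circ>\<^sub>m h)"
    if T': "scheme T'" and h: "h \<in> Mor T' T"
    unfolding eval_section_def mcomp_assoc[OF h p(1) \<psi>]
    using pair_mor_mcomp[OF kschemeD(3)[OF B] kschemeD(3)[OF X] kschemeD(1)[OF B] kschemeD(1)[OF X]
      BX T T' e x eq h] by simp
qed

text \<open>The compatibility over the base field that makes \<psi>(\<beta>, x(v)) a morphism on B x
  V.\<close>

lemma KMor_over:
  assumes BV: "fibre_product B V BV" and x: "x \<in> KMor V X"
  shows "x \<circ>\<^sub>m snd BV \<in> Mor (Apex BV) (Dom X)" "B \<circ>\<^sub>m fst BV = X \<circ>\<^sub>m (x \<circ>\<^sub>m snd BV)"
proof -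
  note v = fibre_productD[OF BV] and x = KMorD[OF x]
  show "x \<circ>\<^sub>m snd BV \<in> Mor (Apex BV) (Dom X)"
    using mcomp_in_Mor[OF v(3) x(1) kschemeD(2)[OF X]] .
  show "B \<circ>\<^sub>m fst BV = X \<circ>\<^sub>m (x \<circ>\<^sub>m snd BV)"
    using mcomp_assoc[OF v(3) x(1) kschemeD(3)[OF X]] x(2) v(4) by simp
qed

text \<open>The composition of \<psi> with Id x x is evaluation at (\<beta>, x(v)), so this is the
  universal property of \<psi> expressed in coordinates.\<close>

lemma sections_represented:
  assumes V: "kscheme K V" and BV: "fibre_product B V BV"
    and \<sigma>: "\<sigma> \<in> Mor (Apex BV) (Dom S)" "\<pi> \<circ>\<^sub>m \<sigma> = fst BV"
  shows "\<exists>!x. x \<in> KMor V X \<and> \<sigma> = eval_section (fst BV) (x \<circ>\<^sub>m snd BV)"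
proof -
  have "section_family K B \<pi> V BV \<sigma>"
    using V BV \<sigma> by (simp add: section_family_def Dom_\<pi>)
  then have "\<exists>!x. x \<in> KMor V X \<and> \<sigma> = \<psi> \<circ>\<^sub>m prod_mor BV BX (idm (Dom B)) x"
    using universal by (cases BV) (simp add: universal_section_family_def)
  then show ?thesis
    using prod_mor_idm(1)[OF B V X BV BX] by (simp add: eval_section_def cong: conj_cong)
qed

lemma eval_section_inject:
  assumes V: "kscheme K V" and BV: "fibre_product B V BV"
    and x: "x \<in> KMor V X" "x' \<in> KMor V X"
    and eq: "eval_section (fst BV) (x \<circ>\<^sub>m snd BV) = eval_section (fst BV) (x' \<circ>\<^sub>m snd BV)"
  shows "x = x'"
proof -
  note ev = eval_section[OF fibre_productD(1,2)[OF BV] KMor_over[OF BV x(1)]]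
  show ?thesis
    using ex1_eq[OF sections_represented[OF V BV ev(1,2)], of x x'] x eq by simp
qed

lemma constant_along_fibres_factors:
  fixes BW :: "('u, 'u, 'u, 'u, 'u, 'u) cone" and u :: "('u, 'u, 'u, 'u) morphism"
  assumes W: "kscheme K W" and BW: "fibre_product B W BW"
    and u: "u \<in> Mor (Apex BW) (Dom X)" "X \<circ>\<^sub>m u = B \<circ>\<^sub>m fst BW"
    and const: "constant_along_fibres u (snd BW)"
  obtains x where "x \<in> KMor W X" "u = x \<circ>\<^sub>m snd BW"
proof -
  note w = fibre_productD[OF BW]
  have D: "Dom (snd BW) = Apex BW" using MorD(1)[OF w(3)] .
  obtain c :: "('u, 'u, 'u, 'u, 'u, 'u) cone"
    where c: "fibre_product (snd BW) (snd BW) c" and uc: "u \<circ>\<^sub>m fst c = u \<circ>\<^sub>m snd c"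
    using const unfolding constant_along_fibres_def by blast
  note C = fibre_productD[OF c, unfolded D]
  note ev = eval_section[OF w(1,2) u(1) u(2)[symmetric]]
  \<comment> \<open>The diagonal section \<psi>(\<beta>, u(\<beta>, w)) over B x W is represented by
    a morphism from W; this is the candidate.\<close>
  obtain x where x: "x \<in> KMor W X"
    and evx: "eval_section (fst BW) u = eval_section (fst BW) (x \<circ>\<^sub>m snd BW)"
    using sections_represented[OF W BW ev(1,2)] by blast
  note xo = KMor_over[OF BW x] and evo = eval_section[OF w(1,2) KMor_over[OF BW x]]
  \<comment> \<open>Over points ((\<beta>', w), (\<beta>, w)) of the fibre product, \<beta>' is
    taken as the argument of a section and (\<beta>, w) as the parameter, so that families with
    parameter scheme B x W can be compared.\<close>
  let ?V = "B \<circ>\<^sub>m fst BW" and ?BV = "(fst BW \<circ>\<^sub>m fst c, snd c)"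
  have V: "kscheme K ?V" using fibre_product_kscheme[OF BW B] .
  have BV: "fibre_product B ?V ?BV" using fibre_product_self_product[OF B W BW c] .
  have "x \<circ>\<^sub>m snd BW \<circ>\<^sub>m fst c = x \<circ>\<^sub>m snd BW \<circ>\<^sub>m snd c"
    using mcomp_assoc[OF C(2) w(3) KMorD(1)[OF x]] mcomp_assoc[OF C(3) w(3) KMorD(1)[OF x]] C(4)
    by simp
  moreover have "eval_section (fst BW) u \<circ>\<^sub>m fst c = eval_section (fst BW) (x \<circ>\<^sub>m snd BW) \<circ>\<^sub>m fst c"
    using evx by simp
  \<comment> \<open>The diagonal equation gives \<psi>(\<beta>', u(\<beta>', w)) = \<psi>(\<beta>',
    x(w)), and constancy along the fibres replaces u(\<beta>', w) by u(\<beta>, w). The parameter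
    then no longer involves \<beta>'.\<close>
  ultimately have "eval_section (fst BW \<circ>\<^sub>m fst c) (u \<circ>\<^sub>m snd c) =
      eval_section (fst BW \<circ>\<^sub>m fst c) (x \<circ>\<^sub>m snd BW \<circ>\<^sub>m snd c)"
    using ev(4)[OF C(1,2)] evo(4)[OF C(1,2)] uc by simp
  moreover have "u \<in> KMor ?V X" "x \<circ>\<^sub>m snd BW \<in> KMor ?V X"
    using u xo D by (simp_all add: KMor_def)
  ultimately have "u = x \<circ>\<^sub>m snd BW"
    using eval_section_inject[OF V BV, of u "x \<circ>\<^sub>m snd BW"] by simp
  then show ?thesis using x that by blast
qed

text \<open>In coordinates, \<open>\<psi>\<^sub>0 (\<beta>, x, y) = (\<psi> (\<beta>, y), x)\<close>.\<close>

lemma swapped_graph_mcomp: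
  fixes SX XX BXX BV :: "('u, 'u, 'u, 'u, 'u, 'u) cone"
  assumes SX: "fibre_product S X SX" and XX: "fibre_product X X XX"
    and BXX: "fibre_product B (X \<circ>\<^sub>m fst XX) BXX"
    and \<psi>\<^sub>0: "\<psi>\<^sub>0 = pair_mor SX (eval_section (fst BXX) (fst XX \<circ>\<^sub>m snd BXX)) (snd XX \<circ>\<^sub>m snd BXX) \<circ>\<^sub>m
      prod_mor BXX BXX (idm (Dom B)) (pair_mor XX (snd XX) (fst XX))"
    and V: "kscheme K V" and BV: "fibre_product B V BV" and g: "g \<in> KMor V (X \<circ>\<^sub>m fst XX)"
  shows "fst XX \<circ>\<^sub>m g \<in> KMor V X" "snd XX \<circ>\<^sub>m g \<in> KMor V X"
    "\<psi>\<^sub>0 \<in> Mor (Apex BXX) (Apex SX)"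
    "fst SX \<circ>\<^sub>m (\<psi>\<^sub>0 \<circ>\<^sub>m prod_mor BV BXX (idm (Dom B)) g) =
      eval_section (fst BV) (snd XX \<circ>\<^sub>m g \<circ>\<^sub>m snd BV)"
    "snd SX \<circ>\<^sub>m (\<psi>\<^sub>0 \<circ>\<^sub>m prod_mor BV BXX (idm (Dom B)) g) = fst XX \<circ>\<^sub>m g \<circ>\<^sub>m snd BV"
proof -
  let ?P = "X \<circ>\<^sub>m fst XX"
  note s = fibre_productD[OF SX] and xx = fibre_productD[OF XX] and bxx = fibre_productD[OF BXX]
    and v = fibre_productD[OF BV]
  have P: "kscheme K ?P" using fibre_product_kscheme[OF XX X] .
  have p: "fst XX \<in> KMor ?P X" "snd XX \<in> KMor ?P X"
    using xx(2,3) by (simp_all add: KMor_def xx(4)[symmetric])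
  show x: "fst XX \<circ>\<^sub>m g \<in> KMor V X" and y: "snd XX \<circ>\<^sub>m g \<in> KMor V X"
    using mcomp_in_KMor[OF g p(1) X] mcomp_in_KMor[OF g p(2) X] .
  let ?sw = "pair_mor XX (snd XX) (fst XX)"
  note sw = pair_mor[OF XX xx(1) xx(3) xx(2) xx(4)[symmetric]]
  have sw_K: "?sw \<in> KMor ?P ?P"
    using sw(1) mcomp_assoc[OF sw(1) xx(2) kschemeD(3)[OF X]] sw(2) by (simp add: KMor_def xx(4)[symmetric])
  note \<iota> = prod_mor_idm[OF B P P BXX BXX sw_K] and G = prod_mor_idm[OF B V P BV BXX g]
    and j = prod_mor_idm[OF B V P BV BXX mcomp_in_KMor[OF g sw_K P]]
    and \<iota>G = prod_mor_idm_mcomp[OF B V P P BV BXX BXX g sw_K]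
  note xo = KMor_over[OF BXX p(1)] and yo = KMor_over[OF BXX p(2)]
  note ev = eval_section[OF bxx(1,2) xo]
  note A = pair_mor[OF SX bxx(1) ev(1) yo(1) ev(3)[unfolded yo(2)]]
  let ?A = "pair_mor SX (eval_section (fst BXX) (fst XX \<circ>\<^sub>m snd BXX)) (snd XX \<circ>\<^sub>m snd BXX)"
  let ?j = "prod_mor BV BXX (idm (Dom B)) (?sw \<circ>\<^sub>m g)"
  show "\<psi>\<^sub>0 \<in> Mor (Apex BXX) (Apex SX)"
    unfolding \<psi>\<^sub>0 using mcomp_in_Mor[OF \<iota>(2) A(1) scheme_closed_stalks[OF s(1)]] .
  \<comment> \<open>The exchange is moved to the parameter: following Id x g by it gives the product
    of Id with \<open>?sw \<circ>\<^sub>m g\<close>, whose components are those of \<open>g\<close>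
    in reverse order.\<close>
  have comp: "\<psi>\<^sub>0 \<circ>\<^sub>m prod_mor BV BXX (idm (Dom B)) g = ?A \<circ>\<^sub>m ?j"
    unfolding \<psi>\<^sub>0 mcomp_assoc[OF G(2) \<iota>(2) A(1)] \<iota>G ..
  note kg = KMorD(1)[OF g, simplified] and ksw = sw(1)
  note gv = mcomp_in_Mor[OF v(3) kg scheme_closed_stalks[OF xx(1)]]
  have snd_j: "snd BXX \<circ>\<^sub>m ?j = ?sw \<circ>\<^sub>m (g \<circ>\<^sub>m snd BV)"
    unfolding j(4) mcomp_assoc[OF v(3) kg ksw] ..
  have fx: "fst XX \<circ>\<^sub>m snd BXX \<circ>\<^sub>m ?j = snd XX \<circ>\<^sub>m g \<circ>\<^sub>m snd BV"
    unfolding mcomp_assoc[OF j(2) bxx(3)[simplified] xx(2)] snd_j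
      mcomp_assoc[OF gv ksw xx(2), symmetric] sw(2) mcomp_assoc[OF v(3) kg xx(3)] ..
  have sx: "snd XX \<circ>\<^sub>m snd BXX \<circ>\<^sub>m ?j = fst XX \<circ>\<^sub>m g \<circ>\<^sub>m snd BV"
    unfolding mcomp_assoc[OF j(2) bxx(3)[simplified] xx(3)] snd_j
      mcomp_assoc[OF gv ksw xx(3), symmetric] sw(3) mcomp_assoc[OF v(3) kg xx(2)] ..
  show "fst SX \<circ>\<^sub>m (\<psi>\<^sub>0 \<circ>\<^sub>m prod_mor BV BXX (idm (Dom B)) g) =
      eval_section (fst BV) (snd XX \<circ>\<^sub>m g \<circ>\<^sub>m snd BV)"
    unfolding comp mcomp_assoc[OF j(2) A(1) s(2), symmetric] A(2) ev(4)[OF v(1) j(2)] j(3) fx ..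
  show "snd SX \<circ>\<^sub>m (\<psi>\<^sub>0 \<circ>\<^sub>m prod_mor BV BXX (idm (Dom B)) g) = fst XX \<circ>\<^sub>m g \<circ>\<^sub>m snd BV"
    unfolding comp mcomp_assoc[OF j(2) A(1) s(3), symmetric] A(3) sx ..
qed

end

theorem theorem5p10:
  fixes K :: "'k ring"
    and S B X X' W :: "('u, 'u, 'k) kscheme"
    and BX SX XX BXX BX' BW :: "('u, 'u, 'u, 'u, 'u, 'u) cone"
    and \<pi> \<psi> \<pi>\<^sub>0 \<iota> \<psi>\<^sub>0 \<delta> \<beta> \<pi>\<^sub>1 q\<^sub>1 b b' \<theta> :: "('u, 'u, 'u, 'u) morphism"
    and \<Delta> E :: "('u, 'u) ideal_sheaf"
  assumes "infinite (UNIV :: 'u set)"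
    and "field K"
    and "piecewise_quasiprojective K S"
    and "projective K B"
    and "integral_scheme (Dom B)"
    and "\<pi> \<in> KMor S B"
    and "universal_section_family K B \<pi> X BX \<psi>"
    and "fibre_product S X SX"
    and "fibre_product X X XX"
    and "fibre_product B (X \<circ>\<^sub>m fst XX) BXX"
    and "\<pi>\<^sub>0 = prod_mor SX BX \<pi> (idm (Dom X))"
    and "\<iota> = prod_mor BXX BXX (idm (Dom B)) (pair_mor XX (snd XX) (fst XX))"
    and "\<psi>\<^sub>0 = pair_mor SX (\<psi> \<circ>\<^sub>m pair_mor BX (fst BXX) (fst XX \<circ>\<^sub>m snd BXX)) (snd XX \<circ>\<^sub>m snd BXX) \<circ>\<^sub>m \<iota>"
    and "\<delta> = pair_mor SX \<psi> (snd BX)"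
    and "\<Delta> = image_ideal \<delta>"
    and "Cod \<beta> = Apex SX"
    and "blow_up \<beta> \<Delta>"
    and "E = inverse_image_ideal \<beta> \<Delta>"
    and "\<pi>\<^sub>1 = \<pi>\<^sub>0 \<circ>\<^sub>m \<beta>"
    and "q\<^sub>1 = snd SX \<circ>\<^sub>m \<beta>"
    and "blow_up_split K B (X \<circ>\<^sub>m fst XX) BXX (inverse_image_ideal \<psi>\<^sub>0 \<Delta>) X' BX' b"
    and "b' \<in> Mor (Apex BX') (Dom \<beta>)"
    and "\<beta> \<circ>\<^sub>m b' = \<psi>\<^sub>0 \<circ>\<^sub>m prod_mor BX' BXX (idm (Dom B)) b"
    and "relative_cluster_family2 K B (fst BX \<circ>\<^sub>m \<pi>\<^sub>1) q\<^sub>1 W BW \<theta>"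
    and "effective_Cartier (Apex BW) (inverse_image_ideal \<theta> E)"
  shows "\<exists>!f. f \<in> KMor W X' \<and> \<theta> = b' \<circ>\<^sub>m prod_mor BW BX' (idm (Dom B)) f"
proof -

  \<comment> \<open>The blow up, its centre and the given family\<close>
  have B: "kscheme K B" and S: "kscheme K S"
    using assms(3,4) by (simp_all add: projective_def piecewise_quasiprojective_def)
  interpret universal_sections K B S X BX \<pi> \<psi>
    using B S assms(6,7) by unfold_locales
  note SX = \<open>fibre_product S X SX\<close> and XX = \<open>fibre_product X X XX\<close>
    and BXX = \<open>fibre_product B (X \<circ>\<^sub>m fst XX) BXX\<close> and b' = \<open>b' \<in> Mor (Apex BX') (Dom \<beta>)\<close>
  let ?P = "X \<circ>\<^sub>m fst XX"
  have P: "kscheme K ?P" using fibre_product_kscheme[OF XX X] .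
  note s = fibre_productD[OF SX] and xx = fibre_productD[OF XX] and bxx = fibre_productD[OF BXX]
    and bx = fibre_productD[OF BX]
  have \<beta>: "\<beta> \<in> Mor (Dom \<beta>) (Apex SX)" and D\<beta>: "scheme (Dom \<beta>)"
    using assms(16,17) by (simp_all add: blow_up_def)
  have \<beta>_ex1: "\<exists>!h. h \<in> Mor T (Dom \<beta>) \<and> \<beta> \<circ>\<^sub>m h = t"
    if "t \<in> Mor T (Apex SX)" "scheme T" "effective_Cartier T (inverse_image_ideal t \<Delta>)"
    for T :: "('u, 'u) ringed_space" and t
    using assms(16,17) that by (simp add: blow_up_def)
  \<comment> \<open>Pulling ideals back along composites requires them to lie in the stalks. For
    \<open>\<Delta>\<close> this uses that the codomain of \<open>\<delta>\<close> is S x X, hence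
    that \<psi> and the projection to X agree over the base field.\<close>
  have \<Delta>_sub: "\<Delta> z \<subseteq> carrier (stalk (Apex SX) z)" if "z \<in> points (Apex SX)" for z
  proof -
    have "Cod \<delta> = Apex SX"
    proof -
      have "S \<circ>\<^sub>m \<psi> = X \<circ>\<^sub>m snd BX"
        using mcomp_assoc[OF \<psi> KMorD(1)[OF \<pi>] kschemeD(3)[OF B]] KMorD(2)[OF \<pi>] \<pi>_\<psi> bx(4) by simp
      from pair_mor(1)[OF SX bx(1) \<psi> bx(3) this] show ?thesis
        unfolding assms(14) by (rule MorD(2))
    qed
    then show ?thesis
      using image_ideal_subset_stalk[of \<delta> z] scheme_closed_stalks[OF s(1)] that
      unfolding assms(15) by simp
  qed
  have pull_\<Delta>: "inverse_image_ideal (h \<circ>\<^sub>m j) \<Delta> = inverse_image_ideal j (inverse_image_ideal h \<Delta>)"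
    if "j \<in> Mor T Y" "h \<in> Mor Y (Apex SX)" "scheme T" "scheme Y"
    for T Y :: "('u, 'u) ringed_space" and h j
    using inverse_image_ideal_mcomp[OF that(1,2) scheme_ringed_space[OF that(3)]
      scheme_ringed_space[OF that(4)] \<Delta>_sub] .
  \<comment> \<open>The second identity will turn the condition over B on \<open>\<theta>\<close>
    into one on its component in S.\<close>
  have \<pi>\<^sub>0: "\<pi>\<^sub>0 \<in> Mor (Apex SX) (Apex BX)" "fst BX \<circ>\<^sub>m \<pi>\<^sub>0 = \<pi> \<circ>\<^sub>m fst SX"
  proof -
    have "\<pi> \<circ>\<^sub>m fst SX \<in> Mor (Apex SX) (Dom B)"
      using mcomp_in_Mor[OF s(2) KMorD(1)[OF \<pi>] kschemeD(2)[OF B]] .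
    moreover have "B \<circ>\<^sub>m (\<pi> \<circ>\<^sub>m fst SX) = X \<circ>\<^sub>m snd SX"
      using mcomp_assoc[OF s(2) KMorD(1)[OF \<pi>] kschemeD(3)[OF B]] KMorD(2)[OF \<pi>] s(4) by simp
    moreover have "\<pi>\<^sub>0 = pair_mor BX (\<pi> \<circ>\<^sub>m fst SX) (snd SX)"
      unfolding assms(11) prod_mor_def idm_mcomp[OF s(3)] ..
    ultimately show "\<pi>\<^sub>0 \<in> Mor (Apex SX) (Apex BX)" "fst BX \<circ>\<^sub>m \<pi>\<^sub>0 = \<pi> \<circ>\<^sub>m fst SX"
      using pair_mor(1,2)[OF BX s(1) _ s(3)] by simp_all
  qed
  let ?\<rho> = "fst BX \<circ>\<^sub>m \<pi>\<^sub>1"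
  have D\<pi>\<^sub>1: "Dom \<pi>\<^sub>1 = Dom \<beta>" by (simp add: assms(19))
  have W: "kscheme K W" and BW: "fibre_product B W BW" and \<theta>: "\<theta> \<in> Mor (Apex BW) (Dom \<beta>)"
    and \<rho>\<theta>: "?\<rho> \<circ>\<^sub>m \<theta> = fst BW" and const: "constant_along_fibres (q\<^sub>1 \<circ>\<^sub>m \<theta>) (snd BW)"
    using assms(24) by (simp_all add: relative_cluster_family2_def section_family_def D\<pi>\<^sub>1)
  note w = fibre_productD[OF BW]
  have X': "kscheme K X'" and BX': "fibre_product B X' BX'" and b: "b \<in> KMor X' ?P"
    using assms(21) by (simp_all add: blow_up_split_def)
  have b_ex1: "\<exists>!h. h \<in> KMor W X' \<and> g = b \<circ>\<^sub>m h"
    if "g \<in> KMor W ?P" "effective_Cartier (Apex BW)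
      (inverse_image_ideal (prod_mor BW BXX (idm (Dom B)) g) (inverse_image_ideal \<psi>\<^sub>0 \<Delta>))" for g
    using assms(21) W BW that by (cases BW) (simp add: blow_up_split_def)

  \<comment> \<open>The components of the family in S and in X\<close>
  define t where "t = \<beta> \<circ>\<^sub>m \<theta>"
  have t: "t \<in> Mor (Apex BW) (Apex SX)"
    unfolding t_def using mcomp_in_Mor[OF \<theta> \<beta> scheme_closed_stalks[OF s(1)]] .
  \<comment> \<open>The pullback of the centre by \<open>t\<close> is the pullback of the
    exceptional divisor by \<open>\<theta>\<close>. Hence \<open>t\<close> lifts uniquely to the
    blow up and determines \<open>\<theta>\<close>.\<close>
  have t_Cartier: "effective_Cartier (Apex BW) (inverse_image_ideal t \<Delta>)"
    using assms(25)
    unfolding t_def pull_\<Delta>[OF \<theta> \<beta> w(1) D\<beta>] assms(18) .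
  define \<sigma> where "\<sigma> = fst SX \<circ>\<^sub>m t"
  define u where "u = snd SX \<circ>\<^sub>m t"
  have \<sigma>: "\<sigma> \<in> Mor (Apex BW) (Dom S)"
    unfolding \<sigma>_def using mcomp_in_Mor[OF t s(2) kschemeD(2)[OF S]] .
  have u: "u \<in> Mor (Apex BW) (Dom X)"
    unfolding u_def using mcomp_in_Mor[OF t s(3) kschemeD(2)[OF X]] .
  have \<pi>\<sigma>: "\<pi> \<circ>\<^sub>m \<sigma> = fst BW"
  proof -
    have "?\<rho> \<circ>\<^sub>m \<theta> = fst BX \<circ>\<^sub>m \<pi>\<^sub>0 \<circ>\<^sub>m \<beta> \<circ>\<^sub>m \<theta>"
      unfolding assms(19) mcomp_assoc[OF \<beta> \<pi>\<^sub>0(1) bx(2)] ..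
    also have "\<dots> = \<pi> \<circ>\<^sub>m fst SX \<circ>\<^sub>m t"
      unfolding t_def \<pi>\<^sub>0(2)
      using mcomp_assoc[OF \<theta> \<beta> mcomp_in_Mor[OF s(2) KMorD(1)[OF \<pi>] kschemeD(2)[OF B]]] .
    also have "\<dots> = \<pi> \<circ>\<^sub>m \<sigma>"
      unfolding \<sigma>_def using mcomp_assoc[OF t s(2) KMorD(1)[OF \<pi>]] .
    finally show ?thesis using \<rho>\<theta> by simp
  qed
  \<comment> \<open>With \<open>B \<circ>\<^sub>m fst BW\<close> as structure morphism of B x W,
    this says that \<open>u\<close> is a morphism over the base field.\<close>
  have Xu: "X \<circ>\<^sub>m u = B \<circ>\<^sub>m fst BW"
  proof -
    have "X \<circ>\<^sub>m u = S \<circ>\<^sub>m \<sigma>"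
      unfolding u_def \<sigma>_def mcomp_assoc[OF t s(3) kschemeD(3)[OF X], symmetric]
        mcomp_assoc[OF t s(2) kschemeD(3)[OF S], symmetric] s(4) ..
    also have "\<dots> = B \<circ>\<^sub>m (\<pi> \<circ>\<^sub>m \<sigma>)"
      using mcomp_assoc[OF \<sigma> KMorD(1)[OF \<pi>] kschemeD(3)[OF B]] KMorD(2)[OF \<pi>] by simp
    finally show ?thesis unfolding \<pi>\<sigma> .
  qed
  have "q\<^sub>1 \<circ>\<^sub>m \<theta> = u"
    unfolding assms(20) u_def t_def using mcomp_assoc[OF \<theta> \<beta> s(3)] .
  then obtain x where x: "x \<in> KMor W X" and ux: "u = x \<circ>\<^sub>m snd BW"
    using constant_along_fibres_factors[OF W BW u Xu] const by metis
  obtain y where y: "y \<in> KMor W X" and \<sigma>y: "\<sigma> = eval_section (fst BW) (y \<circ>\<^sub>m snd BW)"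
    using sections_represented[OF W BW \<sigma> \<pi>\<sigma>] by blast

  \<comment> \<open>Pullbacks along morphisms to X x X and to X'\<close>
  have \<psi>\<^sub>0_eq: "\<psi>\<^sub>0 = pair_mor SX (eval_section (fst BXX) (fst XX \<circ>\<^sub>m snd BXX)) (snd XX \<circ>\<^sub>m snd BXX) \<circ>\<^sub>m
      prod_mor BXX BXX (idm (Dom B)) (pair_mor XX (snd XX) (fst XX))"
    unfolding assms(12,13) eval_section_def ..
  note \<psi>\<^sub>0 = swapped_graph_mcomp[OF SX XX BXX \<psi>\<^sub>0_eq W BW]
  \<comment> \<open>Pulling \<open>inverse_image_ideal \<psi>\<^sub>0 \<Delta>\<close> back by Id x
    g gives the pullback of \<open>\<Delta>\<close> by \<open>t\<close>, already known to be
    Cartier.\<close>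
  have \<psi>\<^sub>0_Cartier: "effective_Cartier (Apex BW)
      (inverse_image_ideal (prod_mor BW BXX (idm (Dom B)) g) (inverse_image_ideal \<psi>\<^sub>0 \<Delta>))"
    if g: "g \<in> KMor W ?P" and eq: "\<psi>\<^sub>0 \<circ>\<^sub>m prod_mor BW BXX (idm (Dom B)) g = t" for g
    using t_Cartier
    unfolding eq[symmetric] pull_\<Delta>[OF prod_mor_idm(2)[OF B W P BW BXX g] \<psi>\<^sub>0(3)[OF g]
      w(1) bxx(1)] .
  have b'_prod: "\<beta> \<circ>\<^sub>m (b' \<circ>\<^sub>m prod_mor BW BX' (idm (Dom B)) f) =
      \<psi>\<^sub>0 \<circ>\<^sub>m prod_mor BW BXX (idm (Dom B)) (b \<circ>\<^sub>m f)"
    "b' \<circ>\<^sub>m prod_mor BW BX' (idm (Dom B)) f \<in> Mor (Apex BW) (Dom \<beta>)"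
    if f: "f \<in> KMor W X'" for f
  proof -
    note F = prod_mor_idm(2)[OF B W X' BW BX' f] and bP = prod_mor_idm(2)[OF B X' P BX' BXX b]
    show "b' \<circ>\<^sub>m prod_mor BW BX' (idm (Dom B)) f \<in> Mor (Apex BW) (Dom \<beta>)"
      using mcomp_in_Mor[OF F b' scheme_closed_stalks[OF D\<beta>]] .
    show "\<beta> \<circ>\<^sub>m (b' \<circ>\<^sub>m prod_mor BW BX' (idm (Dom B)) f) =
      \<psi>\<^sub>0 \<circ>\<^sub>m prod_mor BW BXX (idm (Dom B)) (b \<circ>\<^sub>m f)"
      unfolding mcomp_assoc[OF F b' \<beta>, symmetric] assms(23)
        mcomp_assoc[OF F bP \<psi>\<^sub>0(3)[OF mcomp_in_KMor[OF f b P]]]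
        prod_mor_idm_mcomp[OF B W X' P BW BX' BXX f b] ..
  qed
  \<comment> \<open>The order matters: \<open>\<psi>\<^sub>0\<close> keeps the first factor as the
    coordinate in X and evaluates the second as a section.\<close>
  let ?g = "pair_mor XX x y"
  have xy: "X \<circ>\<^sub>m x = X \<circ>\<^sub>m y" using KMorD(2)[OF x] KMorD(2)[OF y] by simp
  note g' = pair_mor[OF XX kschemeD(1)[OF W] KMorD(1)[OF x] KMorD(1)[OF y] xy]
  have g: "?g \<in> KMor W ?P"
    using g'(1) mcomp_assoc[OF g'(1) xx(2) kschemeD(3)[OF X]] g'(2) KMorD(2)[OF x] by (simp add: KMor_def)
  have \<psi>\<^sub>0g: "\<psi>\<^sub>0 \<circ>\<^sub>m prod_mor BW BXX (idm (Dom B)) ?g = t"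
  proof (rule fibre_product_eqI[OF kschemeD(3)[OF S] kschemeD(3)[OF X] kschemeD(1)[OF S] kschemeD(1)[OF X] SX w(1) _ t])
    show "\<psi>\<^sub>0 \<circ>\<^sub>m prod_mor BW BXX (idm (Dom B)) ?g \<in> Mor (Apex BW) (Apex SX)"
      using mcomp_in_Mor[OF prod_mor_idm(2)[OF B W P BW BXX g] \<psi>\<^sub>0(3)[OF g] scheme_closed_stalks[OF s(1)]] .
  qed (unfold \<psi>\<^sub>0(4,5)[OF g] g'(2,3) \<sigma>_def[symmetric] u_def[symmetric] \<sigma>y ux, rule refl, rule refl)
  note g_Cartier = \<psi>\<^sub>0_Cartier[OF g \<psi>\<^sub>0g]
  obtain f where f: "f \<in> KMor W X'" and gf: "?g = b \<circ>\<^sub>m f"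
    using b_ex1[OF g g_Cartier] by blast
  \<comment> \<open>Blowing down turns the equation for \<open>f'\<close> into one for
    \<open>t\<close>. Comparing components shows that \<open>b \<circ>\<^sub>m f'\<close> is again
    \<open>?g\<close>, and lifts of \<open>?g\<close> along \<open>b\<close> are unique.\<close>
  have unique: "f' = f" if f': "f' \<in> KMor W X'" and eq: "\<theta> = b' \<circ>\<^sub>m prod_mor BW BX' (idm (Dom B)) f'" for f'
  proof -
    note bf' = mcomp_in_KMor[OF f' b P]
    have "t = \<psi>\<^sub>0 \<circ>\<^sub>m prod_mor BW BXX (idm (Dom B)) (b \<circ>\<^sub>m f')"
      unfolding t_def eq b'_prod(1)[OF f'] ..
    then have \<sigma>': "\<sigma> = eval_section (fst BW) (snd XX \<circ>\<^sub>m (b \<circ>\<^sub>m f') \<circ>\<^sub>m snd BW)"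
      and u': "u = fst XX \<circ>\<^sub>m (b \<circ>\<^sub>m f') \<circ>\<^sub>m snd BW"
      unfolding \<sigma>_def u_def using \<psi>\<^sub>0(4,5)[OF bf'] by simp_all
    have y': "snd XX \<circ>\<^sub>m (b \<circ>\<^sub>m f') = y"
      by (rule eval_section_inject[OF W BW \<psi>\<^sub>0(2)[OF bf'] y]) (fact trans[OF \<sigma>'[symmetric] \<sigma>y])
    have "fst XX \<circ>\<^sub>m (b \<circ>\<^sub>m f') \<circ>\<^sub>m snd BW = x \<circ>\<^sub>m snd BW"
      using u' ux by (rule subst)
    \<comment> \<open>The projection from B x W to W can be cancelled here: equal composites with it
      give equal sections over B x W, and these determine the morphism from W to X.\<close>
    then have x': "fst XX \<circ>\<^sub>m (b \<circ>\<^sub>m f') = x"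
      using eval_section_inject[OF W BW \<psi>\<^sub>0(1)[OF bf'] x] by simp
    have "b \<circ>\<^sub>m f' \<in> Mor (Dom W) (Apex XX)" using KMorD(1)[OF bf'] by simp
    from pair_mor_unique[OF kschemeD(3)[OF X] kschemeD(3)[OF X] kschemeD(1)[OF X] kschemeD(1)[OF X]
        XX kschemeD(1)[OF W] this x' y']
    have gf': "?g = b \<circ>\<^sub>m f'" .
    show ?thesis
      by (rule ex1_eq[OF b_ex1[OF g g_Cartier]]) (intro conjI f f' gf gf')+
  qed
  \<comment> \<open>Both sides lift \<open>t\<close> to the blow up, so they agree by uniqueness of
    such a lift.\<close>
  have "\<theta> = b' \<circ>\<^sub>m prod_mor BW BX' (idm (Dom B)) f"
  proof (rule ex1_eq[OF \<beta>_ex1[OF t w(1) t_Cartier]])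
    show "\<theta> \<in> Mor (Apex BW) (Dom \<beta>) \<and> \<beta> \<circ>\<^sub>m \<theta> = t" using \<theta> t_def by simp
    show "b' \<circ>\<^sub>m prod_mor BW BX' (idm (Dom B)) f \<in> Mor (Apex BW) (Dom \<beta>) \<and>
        \<beta> \<circ>\<^sub>m (b' \<circ>\<^sub>m prod_mor BW BX' (idm (Dom B)) f) = t"
      using b'_prod[OF f] \<psi>\<^sub>0g gf by simp
  qed
  with f show ?thesis by (intro ex1I[of _ f] conjI) (use unique in blast)+
qed

end
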